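(* Let $n\ge2$, let $M=S^n$ be the unit sphere with the round metric, and let $\Omega\subset M$ be measurable. Then, for every $\varepsilon>0$, $$\int_{M\times M}K_\varepsilon(x,y)\,|\chi_\Omega(x)-\chi_\Omega(y)|\,dx\,dy=2\sigma_{n-1}\int_0^\pi K_\varepsilon(r)\,\sin(r)^{n-1}\big(c_\Omega(0)-c_\Omega(r)\big)\,dr .$$
   Context: $d$ is the geodesic distance, $dx$, $dy$ the Riemannian volume, $\Delta$ the Laplace–Beltrami operator of the round metric, and $\chi_\Omega$ the characteristic function of $\Omega$. The Helmholtz kernel $K_\varepsilon:M\times M\to\mathbb{R}$ is the unique distributional solution of $K_\varepsilon(\cdot,y)-\varepsilon^2\Delta K_\varepsilon(\cdot,y)=\delta_y$ in $M$ for each $y\in M$; it is smooth outside the diagonal and depends only on the distance, and one writes $K_\varepsilon(x,y)=K_\varepsilon(d(x,y))$, so that $K_\varepsilon(r)$ is defined for $0<r<\pi$. $\sigma_{n-1}$ is the volume of the Euclidean unit sphere $S^{n-1}$. The autocorrelation function of $\Omega$ is $$c_\Omega(r)=\int_M\frac1{\sigma_{n-1}}\int_{S_xM}\chi_\Omega(x)\,\chi_\Omega(\exp_x(rw))\,dS_x(w)\,dx,\qquad r\in\mathbb{R},$$ where $S_xM$ is the unit sphere in $T_xM$ with its surface measure $dS_x$. *)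

theory Defs
  imports "HOL-Analysis.Analysis"
begin

text \<open>
  The round sphere \<open>S\<^sup>n\<close> is the set \<^term>\<open>sphere 0 1\<close> in a Euclidean space \<open>'a\<close> of dimension
  \<open>n + 1\<close>, with the metric induced by the inner product of \<open>'a\<close>.
\<close>

section \<open>Geometry of the unit sphere\<close>

definition tangent_space :: "'a::euclidean_space \<Rightarrow> 'a set" where
  "tangent_space x = {v. orthogonal x v}"

text \<open>Geodesics are great circles, so \<open>exp\<^sub>x\<close> has the following closed form; \<^term>\<open>sgn v\<close> is
  \<open>v / |v|\<close>, and \<open>0\<close> for \<open>v = 0\<close>.\<close>

definition sphere_exp :: "'a::euclidean_space \<Rightarrow> 'a \<Rightarrow> 'a" where
  "sphere_exp x v = cos (norm v) *\<^sub>R x + sin (norm v) *\<^sub>R sgn v"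

definition curve_length :: "(real \<Rightarrow> 'a::euclidean_space) \<Rightarrow> real" where
  "curve_length g = integral {0..1} (\<lambda>t. norm (vector_derivative g (at t)))"

definition geodesic_dist :: "'a::euclidean_space \<Rightarrow> 'a \<Rightarrow> real" where
  "geodesic_dist x y = Inf {curve_length g | g. g C1_differentiable_on {0..1} \<and>
     path_image g \<subseteq> sphere 0 1 \<and> pathstart g = x \<and> pathfinish g = y}"

section \<open>Volume and surface measures\<close>

definition orthonormal_basis :: "'a::euclidean_space set \<Rightarrow> 'a set \<Rightarrow> bool" where
  "orthonormal_basis V B \<longleftrightarrow>
     B \<subseteq> V \<and> pairwise orthogonal B \<and> (\<forall>b\<in>B. norm b = 1) \<and> span B = V"

definition some_onb :: "'a::euclidean_space set \<Rightarrow> 'a set" where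
  "some_onb V = (SOME B. orthonormal_basis V B)"

text \<open>Lebesgue measure on the Borel sets of a linear subspace \<open>V\<close>. It does not depend on the
  orthonormal basis. (The definition of \<^const>\<open>lborel\<close> is the case of the standard basis.)\<close>

definition subspace_lborel :: "'a::euclidean_space set \<Rightarrow> 'a measure" where
  "subspace_lborel V =
     distr (\<Pi>\<^sub>M b\<in>some_onb V. lborel) (restrict_space borel V) (\<lambda>f. \<Sum>b\<in>some_onb V. f b *\<^sub>R b)"

text \<open>
  Riemannian volume (surface measure) on the Borel subsets of the unit sphere \<open>S\<close> of the subspace
  \<open>V\<close>. With \<open>m = dim V\<close>, Lebesgue measure on \<open>V\<close> is \<open>\<rho>\<^sup>m\<^sup>-\<^sup>1 d\<rho> dS\<close> in polar coordinates, so that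
  \<open>dS(A) = m * vol {\<rho> w | w \<in> A, 0 < \<rho> < 1}\<close>.
\<close>

definition unit_sphere_measure :: "'a::euclidean_space set \<Rightarrow> 'a measure" where
  "unit_sphere_measure V =
     scale_measure (of_nat (dim V))
       (distr (restrict_space (subspace_lborel V) (ball 0 1 - {0}))
              (restrict_space borel (sphere 0 1 \<inter> V)) sgn)"

text \<open>The measures below are completed, so that their measurable sets are the Lebesgue
  measurable ones.\<close>

definition sphere_volume :: "'a::euclidean_space measure" where
  "sphere_volume = completion (unit_sphere_measure UNIV)"

definition sphere_volume2 :: "('a::euclidean_space \<times> 'a) measure" where
  "sphere_volume2 = completion (unit_sphere_measure UNIV \<Otimes>\<^sub>M unit_sphere_measure UNIV)"

definition tangent_sphere_measure :: "'a::euclidean_space \<Rightarrow> 'a measure" where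
  "tangent_sphere_measure x = completion (unit_sphere_measure (tangent_space x))"

text \<open>\<open>sphere_area m\<close> is the volume \<open>\<sigma>\<^sub>m\<close> of the Euclidean unit sphere \<open>S\<^sup>m\<close> in \<open>\<real>\<^sup>m\<^sup>+\<^sup>1\<close>; the
  lemma \<open>emeasure_unit_sphere_measure\<close> relates it to \<^const>\<open>unit_sphere_measure\<close>.\<close>

definition sphere_area :: "nat \<Rightarrow> real" where
  "sphere_area m = real (m + 1) * unit_ball_vol (real (m + 1))"

section \<open>Smooth functions and the Laplace--Beltrami operator\<close>

primrec Ck_on :: "nat \<Rightarrow> 'a::euclidean_space set \<Rightarrow> ('a \<Rightarrow> real) \<Rightarrow> bool" where
  "Ck_on 0 W f \<longleftrightarrow> continuous_on W f"
| "Ck_on (Suc k) W f \<longleftrightarrow> (\<forall>x\<in>W. f differentiable (at x)) \<and>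
     (\<forall>b\<in>Basis. Ck_on k W (\<lambda>x. frechet_derivative f (at x) b))"

text \<open>Smoothness on a relatively open subset \<open>U\<close> of the sphere, regarded as an embedded
  submanifold: \<open>f\<close> has local extensions that are smooth in the ambient space.\<close>

definition smooth_on_sphere :: "'a::euclidean_space set \<Rightarrow> ('a \<Rightarrow> real) \<Rightarrow> bool" where
  "smooth_on_sphere U f \<longleftrightarrow> (\<forall>p\<in>U. \<exists>W g. open W \<and> p \<in> W \<and> (\<forall>k. Ck_on k W g) \<and>
     (\<forall>x\<in>W \<inter> U. g x = f x))"

text \<open>Trace of the Riemannian Hessian: \<open>Hess f (b, b)\<close> is the second derivative of \<open>f\<close> along the
  geodesic with initial velocity \<open>b\<close>.\<close>

definition laplace_beltrami :: "('a::euclidean_space \<Rightarrow> real) \<Rightarrow> 'a \<Rightarrow> real" where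
  "laplace_beltrami f x =
     (\<Sum>b\<in>some_onb (tangent_space x). (deriv ^^ 2) (\<lambda>t. f (sphere_exp x (t *\<^sub>R b))) 0)"

section \<open>The Helmholtz kernel and the autocorrelation function\<close>

text \<open>
  \<open>K(\<cdot>, y)\<close> is the function, smooth away from \<open>y\<close>, that solves \<open>u - \<epsilon>\<^sup>2 \<Delta>u = \<delta>\<^sub>y\<close> in the sense of
  distributions. This determines \<open>K x y\<close> for \<open>x \<noteq> y\<close>; the values on the diagonal, a null set,
  are left arbitrary.
\<close>

definition helmholtz_kernel :: "real \<Rightarrow> ('a::euclidean_space \<Rightarrow> 'a \<Rightarrow> real) \<Rightarrow> bool" where
  "helmholtz_kernel \<epsilon> K \<longleftrightarrow> (\<forall>y\<in>sphere 0 1.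
     integrable sphere_volume (\<lambda>x. K x y) \<and>
     smooth_on_sphere (sphere 0 1 - {y}) (\<lambda>x. K x y) \<and>
     (\<forall>\<phi>. smooth_on_sphere (sphere 0 1) \<phi> \<longrightarrow>
        (LINT x|sphere_volume. K x y * (\<phi> x - \<epsilon>\<^sup>2 * laplace_beltrami \<phi> x)) = \<phi> y))"

text \<open>\<open>k\<close> is the one-variable kernel \<open>K(r)\<close>, \<open>0 < r < \<pi>\<close>, in \<open>K(x, y) = K(d(x, y))\<close>.\<close>

definition radial_profile :: "('a::euclidean_space \<Rightarrow> 'a \<Rightarrow> real) \<Rightarrow> (real \<Rightarrow> real) \<Rightarrow> bool" where
  "radial_profile K k \<longleftrightarrow> (\<forall>x\<in>sphere 0 1. \<forall>y\<in>sphere 0 1.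
     0 < geodesic_dist x y \<and> geodesic_dist x y < pi \<longrightarrow> K x y = k (geodesic_dist x y))"

text \<open>The ambient dimension is \<open>n + 1\<close>, so \<open>sphere_area (DIM('a) - 2)\<close> is \<open>\<sigma>\<^sub>n\<^sub>-\<^sub>1\<close>.\<close>

definition autocorrelation :: "'a::euclidean_space set \<Rightarrow> real \<Rightarrow> real" where
  "autocorrelation \<Omega> r =
     (LINT x|sphere_volume. 1 / sphere_area (DIM('a) - 2) *
        (LINT w|tangent_sphere_measure x. indicator \<Omega> x * indicator \<Omega> (sphere_exp x (r *\<^sub>R w))))"

section \<open>Normalisation of the surface measure\<close>

lemma some_onb:
  assumes "subspace V"
  shows "orthonormal_basis V (some_onb V)"
proof -
  have "\<exists>B. orthonormal_basis V B"
    using orthonormal_basis_subspace[OF assms] unfolding orthonormal_basis_def by metis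
  then show ?thesis
    unfolding some_onb_def by (rule someI_ex)
qed

lemma orthonormal_basisD:
  assumes "orthonormal_basis V B"
  shows "finite B" "card B = dim V"
proof -
  have "independent B"
    using assms unfolding orthonormal_basis_def
    by (intro pairwise_orthogonal_independent) (simp, force)
  then show "finite B" "card B = dim V"
    using assms dim_span_eq_card_independent[of B] independent_imp_finite[of B]
    unfolding orthonormal_basis_def by metis+
qed

lemma norm_onb_sum:
  assumes "orthonormal_basis V B"
  shows "norm (\<Sum>b\<in>B. f b *\<^sub>R b) = sqrt (\<Sum>b\<in>B. (f b)\<^sup>2)"
proof -
  have "(norm (\<Sum>b\<in>B. f b *\<^sub>R b))\<^sup>2 = (\<Sum>b\<in>B. (norm (f b *\<^sub>R b))\<^sup>2)"
    using assms unfolding orthonormal_basis_def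
    by (intro norm_sum_Pythagorean orthonormal_basisD[OF assms])
       (auto simp: pairwise_def orthogonal_def)
  also have "\<dots> = (\<Sum>b\<in>B. (f b)\<^sup>2)"
    using assms unfolding orthonormal_basis_def by (intro sum.cong) auto
  finally show ?thesis
    by (simp add: real_sqrt_unique)
qed

lemma emeasure_unit_sphere_measure:
  fixes V :: "'a::euclidean_space set"
  assumes V: "subspace V" and dim: "dim V = m + 1"
  shows "emeasure (unit_sphere_measure V) (sphere 0 1 \<inter> V) = ennreal (sphere_area m)"
proof -
  let ?B = "some_onb V" and ?L = "\<Pi>\<^sub>M b\<in>some_onb V. (lborel :: real measure)"
  let ?s = "\<lambda>f. \<Sum>b\<in>?B. f b *\<^sub>R b" and ?D = "ball 0 1 - {0} :: 'a set"
  have onb: "orthonormal_basis V ?B"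
    by (rule some_onb[OF V])
  have fin: "finite ?B" and card: "card ?B = m + 1"
    using orthonormal_basisD[OF onb] dim by auto
  have s_V: "?s f \<in> V" for f
    using onb unfolding orthonormal_basis_def
    by (intro subspace_sum[OF V] subspace_scale[OF V]) blast
  have norm_s: "norm (?s f) = sqrt (\<Sum>b\<in>?B. (f b)\<^sup>2)" for f
    by (rule norm_onb_sum[OF onb])
  have s_meas: "?s \<in> ?L \<rightarrow>\<^sub>M restrict_space borel V"
    using s_V by (intro measurable_restrict_space2) (auto intro!: borel_measurable_sum)
  have sets_L: "sets (subspace_lborel V) = sets (restrict_space borel V)"
    and space_L: "space (subspace_lborel V) = V"
    by (simp_all add: subspace_lborel_def space_restrict_space)
  have sgn_meas: "sgn \<in> restrict_space (subspace_lborel V) ?D \<rightarrow>\<^sub>M restrict_space borel (sphere 0 1 \<inter> V)"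
  proof (rule measurable_restrict_space2)
    show "sgn \<in> space (restrict_space (subspace_lborel V) ?D) \<rightarrow> sphere 0 1 \<inter> V"
      using V by (auto simp: space_restrict_space space_L norm_sgn sgn_div_norm subspace_scale)
    have "sgn \<in> borel \<rightarrow>\<^sub>M (borel :: 'a measure)"
      unfolding sgn_div_norm by measurable
    then have "sgn \<in> restrict_space borel V \<rightarrow>\<^sub>M (borel :: 'a measure)"
      by (rule measurable_restrict_space1)
    then have "sgn \<in> subspace_lborel V \<rightarrow>\<^sub>M (borel :: 'a measure)"
      by (simp cong: measurable_cong_sets add: sets_L)
    then show "sgn \<in> restrict_space (subspace_lborel V) ?D \<rightarrow>\<^sub>M borel"
      by (rule measurable_restrict_space1)
  qed
  have vol: "emeasure (subspace_lborel V) (A \<inter> V) = emeasure ?L ({f. ?s f \<in> A} \<inter> space ?L)"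
    if "A \<in> sets borel" for A
  proof -
    have "A \<inter> V \<in> sets (restrict_space borel V)"
      using that by (auto simp: sets_restrict_space)
    then show ?thesis
      unfolding subspace_lborel_def using s_V
      by (subst emeasure_distr[OF s_meas]) (auto intro!: arg_cong2[where f=emeasure])
  qed
  have cb: "emeasure (subspace_lborel V) (cball 0 r \<inter> V) =
      ennreal (unit_ball_vol (real (m + 1)) * r ^ (m + 1))" if "r > 0" for r
    using vol[of "cball 0 r"] emeasure_cball_aux[OF fin that] card by (simp add: norm_s)
  have sets_Int: "A \<inter> V \<in> sets (subspace_lborel V)" if "A \<in> sets borel" for A
    using that by (auto simp: sets_L sets_restrict_space)
  have D_sets: "?D \<inter> space (subspace_lborel V) \<in> sets (subspace_lborel V)"
    unfolding space_L by (rule sets_Int) simp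
  have D: "emeasure (subspace_lborel V) (?D \<inter> V) = ennreal (unit_ball_vol (real (m + 1)))"
  proof (rule antisym)
    have "emeasure (subspace_lborel V) (?D \<inter> V) \<le> emeasure (subspace_lborel V) (cball 0 1 \<inter> V)"
      by (intro emeasure_mono sets_Int) auto
    then show "emeasure (subspace_lborel V) (?D \<inter> V) \<le> ennreal (unit_ball_vol (real (m + 1)))"
      using cb[of 1] by simp
  next
    let ?c = "unit_ball_vol (real (m + 1))"
    have *: "ennreal (?c * ((1 - r) ^ (m + 1) - r ^ (m + 1))) \<le> emeasure (subspace_lborel V) (?D \<inter> V)"
      if "0 < r" "r < 1/2" for r
    proof -
      have "ennreal (?c * ((1 - r) ^ (m + 1) - r ^ (m + 1))) =
          ennreal (?c * (1 - r) ^ (m + 1)) - ennreal (?c * r ^ (m + 1))"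
        using that by (subst ennreal_minus) (auto simp: right_diff_distrib)
      also have "\<dots> = emeasure (subspace_lborel V) (cball 0 (1 - r) \<inter> V - cball 0 r \<inter> V)"
        using that cb[of r] cb[of "1 - r"]
        by (subst emeasure_Diff) (auto intro!: sets_Int)
      also have "\<dots> \<le> emeasure (subspace_lborel V) (?D \<inter> V)"
        using D_sets that by (intro emeasure_mono) (auto simp: space_L)
      finally show ?thesis .
    qed
    have "((\<lambda>r. ennreal (c * ((1 - r) ^ (m + 1) - r ^ (m + 1)))) \<longlongrightarrow>
        ennreal (c * ((1 - 0) ^ (m + 1) - 0 ^ (m + 1)))) (at_right (0::real))" for c
      by (intro tendsto_ennrealI tendsto_intros)
    note this[of ?c]
    moreover have "eventually (\<lambda>r::real. 0 < r \<and> r < 1/2) (at_right 0)"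
      by (auto simp: eventually_at_right_field intro!: exI[of _ "1/2"])
    then have "eventually (\<lambda>r. ennreal (?c * ((1 - r) ^ (m + 1) - r ^ (m + 1)))
        \<le> emeasure (subspace_lborel V) (?D \<inter> V)) (at_right (0::real))"
      by (rule eventually_mono) (use * in blast)
    ultimately have "ennreal (?c * ((1 - 0) ^ (m + 1) - 0 ^ (m + 1))) \<le>
        emeasure (subspace_lborel V) (?D \<inter> V)"
      by (rule tendsto_upperbound) simp
    then show "ennreal ?c \<le> emeasure (subspace_lborel V) (?D \<inter> V)"
      by simp
  qed
  have "emeasure (distr (restrict_space (subspace_lborel V) ?D)
      (restrict_space borel (sphere 0 1 \<inter> V)) sgn) (sphere 0 1 \<inter> V) =
      emeasure (restrict_space (subspace_lborel V) ?D)
        (sgn -` (sphere 0 1 \<inter> V) \<inter> space (restrict_space (subspace_lborel V) ?D))"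
    by (rule emeasure_distr[OF sgn_meas]) (auto simp: sets_restrict_space)
  also have "sgn -` (sphere 0 1 \<inter> V) \<inter> space (restrict_space (subspace_lborel V) ?D) = ?D \<inter> V"
    using V by (auto simp: space_restrict_space space_L norm_sgn sgn_div_norm subspace_scale)
  also have "emeasure (restrict_space (subspace_lborel V) ?D) (?D \<inter> V) =
      emeasure (subspace_lborel V) (?D \<inter> V)"
    by (intro emeasure_restrict_space D_sets) auto
  finally show ?thesis
    unfolding unit_sphere_measure_def sphere_area_def emeasure_scale_measure dim D
    by (simp add: ennreal_mult'' ennreal_of_nat_eq_real_of_nat del: of_nat_Suc of_nat_add)
qed

end

theory Submission
  imports Defs
begin

text \<open>
  Since \<open>|\<chi>(x) - \<chi>(y)| = \<chi>(x) + \<chi>(y) - 2 \<chi>(x) \<chi>(y)\<close>, it suffices to integrate \<open>k(d(x, y))\<close> over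
  \<open>A \<times> M\<close>, \<open>M \<times> A\<close> and \<open>A \<times> A\<close> for a Borel set \<open>A\<close> that differs from \<open>\<Omega>\<close> by a null set. Geodesic polar
  coordinates about \<open>x\<close>, together with \<open>d(x, y) = arccos (x \<bullet> y)\<close>, turn each of these into an integral
  of \<open>k(r) sin(r)\<^sup>n\<^sup>-\<^sup>1\<close> against a function of \<open>r\<close>, which for \<open>A \<times> A\<close> is a multiple of the
  autocorrelation of \<open>A\<close>.

  The autocorrelation of \<open>\<Omega>\<close> has to be replaced by that of \<open>A\<close> for every \<open>r\<close>, not just for almost every
  \<open>r\<close>, because the integral over \<open>r\<close> is taken with respect to the uncompleted measure \<^const>\<open>lborel\<close>.
  This requires that averages over pairs at distance \<open>r\<close> vanish on null sets, which follows from
  rotation invariance.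
\<close>

text \<open>The surface measures are defined through volumes of cones, and those of tangent spaces
  also through an arbitrarily chosen orthonormal basis. Polar coordinates on the sphere therefore
  have to be extracted from Lebesgue measure on the ambient space: split \<open>v = t x + u\<close>
  with \<open>u\<close> orthogonal to \<open>x\<close> and substitute \<open>t = |u| cot r\<close>.
  Before that, the weight 1 of the cone measure is replaced by \<open>1 / |v|\<close>. This weight
  cancels the factor \<open>|u|\<close> of the Jacobian, and the replacement turns the dimension
  factor \<open>n + 1\<close> of the sphere into the factor \<open>n\<close> that normalises the
  tangent spheres, so no constant is left over.

  The factor \<open>2 sphere_area (n - 1)\<close> arises from \<open>A \<times> M\<close> and
  \<open>M \<times> A\<close>, which contribute \<open>sphere_area (n - 1)\<close> times
  \<open>c(0)\<close> each, and from \<open>A \<times> A\<close>, which carries the coefficient -2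
  and contributes \<open>sphere_area (n - 1)\<close> times \<open>c(r)\<close>. The kernel is
  signed, so this splitting needs integrability over pairs. It is derived from the integrability of
  \<open>K(\<cdot>, y0)\<close> for a single \<open>y0\<close>, by polar coordinates about
  \<open>y0\<close>.\<close>

subsection \<open>Orthogonal invariance of Lebesgue measure\<close>

text \<open>The usual uniqueness argument for Haar measure: apply Fubini to \<open>1\<^sub>A(x + y) 1\<^sub>B(y)\<close>, where \<open>B\<close> is
  the unit ball.\<close>

lemma lborel_eq_translation_invariant:
  fixes M :: "'a::euclidean_space measure"
  assumes sf: "sigma_finite_measure M" and sets [measurable_cong]: "sets M = sets borel"
    and inv: "\<And>a. distr M borel ((+) a) = M"
    and ball: "emeasure M (cball 0 1) = emeasure lborel (cball (0::'a) 1)"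
  shows "M = lborel"
proof (rule measure_eqI)
  interpret M: sigma_finite_measure M by (rule sf)
  interpret P: pair_sigma_finite M lborel ..
  let ?B = "cball (0::'a) 1"
  fix A assume "A \<in> sets M"
  then have [measurable]: "A \<in> sets borel" by (simp add: sets)
  have B [measurable]: "?B \<in> sets borel" by simp
  have trans: "(\<integral>\<^sup>+x. f x \<partial>M) = (\<integral>\<^sup>+x. f (a + x) \<partial>M)" if [measurable]: "f \<in> borel_measurable borel" for f :: "'a \<Rightarrow> ennreal" and a
    by (subst inv[of a, symmetric], subst nn_integral_distr) auto
  have trans': "(\<integral>\<^sup>+x. f x \<partial>lborel) = (\<integral>\<^sup>+x. f (a + x) \<partial>lborel)" if [measurable]: "f \<in> borel_measurable borel" for f :: "'a \<Rightarrow> ennreal" and a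
    by (subst lborel_distr_plus[of a, symmetric], subst nn_integral_distr) auto
  have "emeasure M A * emeasure lborel ?B = (\<integral>\<^sup>+y. (\<integral>\<^sup>+x. indicator A x * indicator ?B y \<partial>M) \<partial>lborel)"
    by (simp add: nn_integral_multc nn_integral_cmult sets)
  also have "\<dots> = (\<integral>\<^sup>+y. (\<integral>\<^sup>+x. indicator A (y + x) * indicator ?B y \<partial>M) \<partial>lborel)"
    by (intro nn_integral_cong trans) measurable
  also have "\<dots> = (\<integral>\<^sup>+x. (\<integral>\<^sup>+y. indicator A (y + x) * indicator ?B y \<partial>lborel) \<partial>M)"
    by (rule P.Fubini') measurable
  also have "\<dots> = (\<integral>\<^sup>+x. (\<integral>\<^sup>+y. indicator A y * indicator ?B (y - x) \<partial>lborel) \<partial>M)"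
  proof (rule nn_integral_cong)
    fix x
    show "(\<integral>\<^sup>+y. indicator A (y + x) * indicator ?B y \<partial>lborel) = (\<integral>\<^sup>+y. indicator A y * indicator ?B (y - x) \<partial>lborel)"
      by (subst trans'[of "\<lambda>y. indicator A y * indicator ?B (y - x)" x]) (auto simp: add.commute)
  qed
  also have "\<dots> = (\<integral>\<^sup>+y. (\<integral>\<^sup>+x. indicator A y * indicator ?B (y - x) \<partial>M) \<partial>lborel)"
    by (rule P.Fubini'[symmetric]) measurable
  also have "\<dots> = (\<integral>\<^sup>+y. indicator A y * emeasure M ?B \<partial>lborel)"
  proof (rule nn_integral_cong)
    fix y
    have "(\<integral>\<^sup>+x. indicator A y * indicator ?B (y - x) \<partial>M) = (\<integral>\<^sup>+x. indicator A y * indicator ?B (y - (y + x)) \<partial>M)"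
      by (rule trans) auto
    \<comment> \<open>\<open>y - (y + x) = - x\<close>, and the ball is symmetric about 0.\<close>
    also have "\<dots> = (\<integral>\<^sup>+x. indicator A y * indicator ?B x \<partial>M)"
      by (intro nn_integral_cong) (auto simp: indicator_def)
    also have "\<dots> = indicator A y * emeasure M ?B"
      by (simp add: nn_integral_cmult sets)
    finally show "(\<integral>\<^sup>+x. indicator A y * indicator ?B (y - x) \<partial>M) = indicator A y * emeasure M ?B" .
  qed
  also have "\<dots> = emeasure lborel A * emeasure M ?B"
    by (simp add: nn_integral_multc)
  finally have eq: "emeasure M A * emeasure lborel ?B = emeasure lborel A * emeasure lborel ?B"
    by (simp add: ball)
  \<comment> \<open>The volume of the ball is positive and finite, so it can be cancelled.\<close>
  have "emeasure lborel ?B = ennreal (unit_ball_vol DIM('a))"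
    by (simp add: emeasure_cball)
  then show "emeasure M A = emeasure lborel A"
    using eq less_imp_neq[OF unit_ball_vol_pos[of "real DIM('a)", OF of_nat_0_le_iff]]
    by (auto simp: mult.commute[of _ "ennreal _"] ennreal_mult_cancel_left)
qed (simp add: sets)

lemma borel_measurable_orthogonal_transformation:
  fixes T :: "'a::euclidean_space \<Rightarrow> 'a"
  assumes T: "orthogonal_transformation T"
  shows "T \<in> borel_measurable borel"
  using orthogonal_transformation_linear[OF T] linear_continuous_on[of T UNIV]
  by (intro borel_measurable_continuous_onI) (simp add: linear_conv_bounded_linear)

text \<open>The image measure is again translation invariant because \<open>T\<close> is onto: with
  \<open>a = T b\<close>, translating by \<open>a\<close> after \<open>T\<close> is the same as
  applying \<open>T\<close> after translating by \<open>b\<close>. The unit ball is its own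
  preimage, which fixes the normalisation.\<close>

lemma distr_lborel_orthogonal_transformation:
  fixes T :: "'a::euclidean_space \<Rightarrow> 'a"
  assumes T: "orthogonal_transformation T"
  shows "distr lborel borel T = lborel"
proof (rule lborel_eq_translation_invariant)
  have lin: "linear T" using T by (rule orthogonal_transformation_linear)
  note [measurable] = borel_measurable_orthogonal_transformation[OF T]
  have pre: "T -` cball 0 r = cball 0 r" for r
    using orthogonal_transformation_norm[OF T] by auto
  show "emeasure (distr lborel borel T) (cball 0 1) = emeasure lborel (cball (0::'a) 1)"
    by (simp add: emeasure_distr pre)
  show "sigma_finite_measure (distr lborel borel T)"
  proof
    show "\<exists>A. countable A \<and> A \<subseteq> sets (distr lborel borel T) \<and> \<Union>A = space (distr lborel borel T) \<and> (\<forall>a\<in>A. emeasure (distr lborel borel T) a \<noteq> \<infinity>)"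
    proof (intro exI conjI ballI)
      show "countable (range (\<lambda>i. cball (0::'a) (real i)))" by simp
      show "\<Union>(range (\<lambda>i. cball (0::'a) (real i))) = space (distr lborel borel T)"
        using real_arch_simple by auto
      fix a assume "a \<in> range (\<lambda>i. cball (0::'a) (real i))"
      then obtain i where "a = cball 0 (real i)" by auto
      then show "emeasure (distr lborel borel T) a \<noteq> \<infinity>"
        using emeasure_bounded_finite[of "cball (0::'a) (real i)"] by (simp add: emeasure_distr pre)
    qed auto
  qed
  fix a
  obtain b where b: "a = T b" using orthogonal_transformation_surj[OF T] by (metis surjD)
  have "distr (distr lborel borel T) borel ((+) a) = distr (distr lborel borel ((+) b)) borel T"
    by (simp add: distr_distr comp_def b linear_add[OF lin])
  then show "distr (distr lborel borel T) borel ((+) a) = distr lborel borel T"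
    by (simp add: lborel_distr_plus)
qed simp

text \<open>\<open>subspace_lborel\<close> selects its basis by \<open>SOME\<close>, so independence
  of the basis is needed before it can be compared with \<open>lborel\<close>. An orthogonal map
  \<open>T\<close> carrying the standard basis to \<open>B\<close> reduces the claim to
  \<open>lborel_eq\<close>; \<open>R\<close> merely renames coordinates along the bijection.\<close>

lemma lborel_eq_orthonormal_basis:
  fixes B :: "'a::euclidean_space set"
  assumes B: "orthonormal_basis UNIV B"
  shows "lborel = distr (\<Pi>\<^sub>M b\<in>B. lborel) borel (\<lambda>f. \<Sum>b\<in>B. f b *\<^sub>R b)"
proof -
  have fin: "finite B" and card: "card B = DIM('a)"
    using orthonormal_basisD[OF B] by auto
  then obtain p where p: "bij_betw p (Basis::'a set) B"
    using finite_same_card_bij[of "Basis::'a set" B] by auto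
  define q where "q = inv_into Basis p"
  have q: "bij_betw q B Basis" unfolding q_def using p by (rule bij_betw_inv_into)
  have qB: "q b \<in> Basis" if "b \<in> B" for b using q that by (auto simp: bij_betw_def)
  have pB: "p i \<in> B" if "i \<in> Basis" for i using p that by (auto simp: bij_betw_def)
  have qp: "q (p i) = i" if "i \<in> Basis" for i
    unfolding q_def using p that by (simp add: bij_betw_inv_into_left)
  have pq: "p (q b) = b" if "b \<in> B" for b
    unfolding q_def using p that by (simp add: bij_betw_inv_into_right)
  define T :: "'a \<Rightarrow> 'a" where "T x = (\<Sum>i\<in>Basis. (x \<bullet> i) *\<^sub>R p i)" for x
  have T_eq: "T x = (\<Sum>b\<in>B. (x \<bullet> q b) *\<^sub>R b)" for x
    unfolding T_def using sum.reindex_bij_betw[OF p, of "\<lambda>b. (x \<bullet> q b) *\<^sub>R b"] by (simp add: qp cong: sum.cong)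
  have lin: "linear T"
    unfolding T_def by (intro linearI) (simp_all add: inner_add_left scaleR_add_left sum.distrib scaleR_right.sum)
  have "norm (T x) = norm x" for x
  proof -
    have "norm (T x) = sqrt (\<Sum>b\<in>B. (x \<bullet> q b)\<^sup>2)"
      unfolding T_eq by (rule norm_onb_sum[OF B])
    also have "(\<Sum>b\<in>B. (x \<bullet> q b)\<^sup>2) = (\<Sum>i\<in>Basis. (x \<bullet> i)\<^sup>2)"
      using sum.reindex_bij_betw[OF q, of "\<lambda>i. (x \<bullet> i)\<^sup>2"] by simp
    also have "sqrt \<dots> = norm x"
      by (simp add: norm_eq_sqrt_inner euclidean_inner[of x x] power2_eq_square)
    finally show ?thesis .
  qed
  then have T: "orthogonal_transformation T" using lin by (simp add: orthogonal_transformation)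
  note [measurable] = borel_measurable_orthogonal_transformation[OF T]
  define R where "R f = (\<lambda>b\<in>B. f (q b))" for f :: "'a \<Rightarrow> real"
  have [measurable]: "R \<in> (\<Pi>\<^sub>M i\<in>Basis. lborel) \<rightarrow>\<^sub>M (\<Pi>\<^sub>M b\<in>B. lborel)"
    unfolding R_def using qB by (intro measurable_restrict measurable_component_singleton) auto
  interpret L: product_sigma_finite "\<lambda>_::'a. lborel :: real measure" ..
  have R: "distr (\<Pi>\<^sub>M i\<in>Basis. lborel) (\<Pi>\<^sub>M b\<in>B. lborel) R = (\<Pi>\<^sub>M b\<in>B. lborel)"
  proof (rule L.PiM_eqI[OF fin])
    fix A :: "'a \<Rightarrow> real set" assume A: "\<And>i. i \<in> B \<Longrightarrow> A i \<in> sets lborel"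
    have "R -` Pi\<^sub>E B A \<inter> space (\<Pi>\<^sub>M i\<in>Basis. lborel) = Pi\<^sub>E Basis (\<lambda>i. A (p i))"
    proof (intro set_eqI iffI)
      fix f assume f: "f \<in> R -` Pi\<^sub>E B A \<inter> space (\<Pi>\<^sub>M i\<in>Basis. lborel)"
      then have "R f (p i) \<in> A (p i)" if "i \<in> Basis" for i
        using pB[OF that] by (auto simp: PiE_iff)
      moreover from f have "f \<in> extensional Basis"
        by (simp add: space_PiM PiE_def)
      ultimately show "f \<in> Pi\<^sub>E Basis (\<lambda>i. A (p i))"
        using pB qp by (auto simp: R_def PiE_iff)
    next
      fix f assume f: "f \<in> Pi\<^sub>E Basis (\<lambda>i. A (p i))"
      have "f (q b) \<in> A b" if "b \<in> B" for b
        using PiE_mem[OF f qB[OF that]] pq[OF that] by simp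
      then show "f \<in> R -` Pi\<^sub>E B A \<inter> space (\<Pi>\<^sub>M i\<in>Basis. lborel)"
        using f by (simp add: R_def PiE_iff space_PiM)
    qed
    then have "emeasure (distr (\<Pi>\<^sub>M i\<in>Basis. lborel) (\<Pi>\<^sub>M b\<in>B. lborel) R) (Pi\<^sub>E B A) = (\<Prod>i\<in>Basis. emeasure lborel (A (p i)))"
      using A pB by (subst emeasure_distr) (auto intro!: sets_PiM_I_finite fin L.emeasure_PiM)
    also have "\<dots> = (\<Prod>b\<in>B. emeasure lborel (A b))"
      using prod.reindex_bij_betw[OF p, of "\<lambda>b. emeasure lborel (A b)"] by simp
    finally show "emeasure (distr (\<Pi>\<^sub>M i\<in>Basis. lborel) (\<Pi>\<^sub>M b\<in>B. lborel) R) (Pi\<^sub>E B A) = (\<Prod>b\<in>B. emeasure lborel (A b))" .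
  qed simp
  have "(\<Sum>b\<in>B. R f b *\<^sub>R b) = T (\<Sum>i\<in>Basis. f i *\<^sub>R i)" for f
    unfolding T_eq by (rule sum.cong) (auto simp: R_def qB inner_sum_left inner_Basis if_distrib[of "\<lambda>x. _ * x"] cong: if_cong)
  then have "distr (\<Pi>\<^sub>M b\<in>B. lborel) borel (\<lambda>f. \<Sum>b\<in>B. f b *\<^sub>R b) =
      distr (\<Pi>\<^sub>M i\<in>Basis. lborel) borel (\<lambda>f. T (\<Sum>i\<in>Basis. f i *\<^sub>R i))"
    by (subst R[symmetric], subst distr_distr) (auto simp: comp_def)
  also have "\<dots> = distr lborel borel T"
    by (subst lborel_eq, subst distr_distr) (auto simp: comp_def)
  also have "\<dots> = lborel" by (rule distr_lborel_orthogonal_transformation[OF T])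
  finally show ?thesis by simp
qed

lemma nn_integral_lborel_scaleR:
  fixes F :: "'a::euclidean_space \<Rightarrow> ennreal"
  assumes [measurable]: "F \<in> borel_measurable borel" and c: "c > 0"
  shows "(\<integral>\<^sup>+v. F v \<partial>lborel) = ennreal (c ^ DIM('a)) * (\<integral>\<^sup>+v. F (c *\<^sub>R v) \<partial>lborel)"
proof -
  have "(\<integral>\<^sup>+v. F v \<partial>lborel) = (\<integral>\<^sup>+v. F v \<partial>density (distr lborel borel (\<lambda>x. 0 + c *\<^sub>R x)) (\<lambda>_. \<bar>c\<bar> ^ DIM('a)))"
    using c by (subst lborel_affine[of c 0]) auto
  also have "\<dots> = ennreal (c ^ DIM('a)) * (\<integral>\<^sup>+v. F (c *\<^sub>R v) \<partial>lborel)"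
    using c by (simp add: nn_integral_density nn_integral_distr nn_integral_cmult)
  finally show ?thesis .
qed

subsection \<open>Lebesgue measure on tangent spaces\<close>

lemma subspace_tangent_space: "subspace (tangent_space x)"
  unfolding tangent_space_def by (rule subspace_orthogonal_to_vector)

text \<open>Extends the very basis that \<open>subspace_lborel (tangent_space x)\<close> selects, so
  that splitting off one factor of a product measure separates the direction \<open>x\<close> from
  the tangent space.\<close>

lemma orthonormal_basis_insert_tangent:
  fixes x :: "'a::euclidean_space"
  assumes x: "x \<in> sphere 0 1"
  shows "x \<notin> some_onb (tangent_space x)"
    and "orthonormal_basis UNIV (insert x (some_onb (tangent_space x)))"
proof -
  let ?B = "some_onb (tangent_space x)"
  have B: "orthonormal_basis (tangent_space x) ?B"
    by (rule some_onb[OF subspace_tangent_space])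
  then have sub: "?B \<subseteq> tangent_space x" and sp: "span ?B = tangent_space x"
    by (auto simp: orthonormal_basis_def)
  have xx: "x \<bullet> x = 1" using x by (simp add: dot_square_norm)
  show "x \<notin> ?B"
    using sub xx by (auto simp: tangent_space_def orthogonal_def)
  have "v \<in> span (insert x ?B)" for v
  proof -
    have "v - (v \<bullet> x) *\<^sub>R x \<in> span ?B"
      unfolding sp by (simp add: tangent_space_def orthogonal_def inner_diff_right inner_commute xx)
    then show ?thesis by (auto simp: span_breakdown_eq)
  qed
  then show "orthonormal_basis UNIV (insert x ?B)"
    using B x sub unfolding orthonormal_basis_def
    by (auto simp: pairwise_insert tangent_space_def orthogonal_commute)
qed

lemma dim_tangent_space:
  fixes x :: "'a::euclidean_space"
  assumes x: "x \<in> sphere 0 1"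
  shows "dim (tangent_space x) = DIM('a) - 1"
  using orthonormal_basisD[OF orthonormal_basis_insert_tangent(2)[OF x]] orthonormal_basis_insert_tangent(1)[OF x]
    orthonormal_basisD[OF some_onb[OF subspace_tangent_space[of x]]]
  by simp

lemma space_subspace_lborel [simp]: "space (subspace_lborel V) = V"
  by (simp add: subspace_lborel_def space_restrict_space)

lemma sets_subspace_lborel: "sets (subspace_lborel V) = sets (restrict_space borel V)"
  by (simp add: subspace_lborel_def)

lemma borel_measurable_subspace_lborel:
  "f \<in> borel \<rightarrow>\<^sub>M M \<Longrightarrow> f \<in> subspace_lborel V \<rightarrow>\<^sub>M M"
  by (simp add: measurable_cong_sets[OF sets_subspace_lborel refl] measurable_restrict_space1)

lemma nn_integral_subspace_lborel:
  fixes V :: "'a::euclidean_space set"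
  assumes V: "subspace V" and G: "G \<in> borel_measurable borel"
  shows "(\<integral>\<^sup>+u. G u \<partial>subspace_lborel V) =
    (\<integral>\<^sup>+f. G (\<Sum>b\<in>some_onb V. f b *\<^sub>R b) \<partial>(\<Pi>\<^sub>M b\<in>some_onb V. lborel))"
proof -
  have "(\<Sum>b\<in>some_onb V. f b *\<^sub>R b) \<in> V" for f
    using some_onb[OF V] unfolding orthonormal_basis_def
    by (intro subspace_sum[OF V] subspace_scale[OF V]) blast
  then have "(\<lambda>f. \<Sum>b\<in>some_onb V. f b *\<^sub>R b) \<in> (\<Pi>\<^sub>M b\<in>some_onb V. lborel) \<rightarrow>\<^sub>M restrict_space borel V"
    by (intro measurable_restrict_space2) (auto intro!: borel_measurable_sum)
  then show ?thesis
    unfolding subspace_lborel_def using G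
    by (subst nn_integral_distr) (auto intro: measurable_restrict_space1)
qed

lemma subspace_lborel_UNIV: "subspace_lborel UNIV = (lborel :: 'a::euclidean_space measure)"
proof -
  have "restrict_space borel UNIV = (borel :: 'a measure)"
    using measure_of_of_measure[of "borel :: 'a measure"] by (simp add: restrict_space_def)
  then show ?thesis
    unfolding subspace_lborel_def
    using lborel_eq_orthonormal_basis[OF some_onb[OF subspace_UNIV], symmetric] by simp
qed

text \<open>Both orders of integration are read off the product measure over
  \<open>insert x B\<close>. With \<open>t\<close> outside, a factor depending on \<open>t\<close>
  alone can be pulled out; with \<open>t\<close> inside, one integrates along lines parallel to
  \<open>x\<close>, as polar coordinates require.\<close>

lemma nn_integral_lborel_tangent:
  fixes F :: "'a::euclidean_space \<Rightarrow> ennreal"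
  assumes x: "x \<in> sphere 0 1" and [measurable]: "F \<in> borel_measurable borel"
  shows "(\<integral>\<^sup>+v. F v \<partial>lborel) = (\<integral>\<^sup>+t. \<integral>\<^sup>+u. F (t *\<^sub>R x + u) \<partial>subspace_lborel (tangent_space x) \<partial>lborel)"
    and "(\<integral>\<^sup>+v. F v \<partial>lborel) = (\<integral>\<^sup>+u. \<integral>\<^sup>+t. F (t *\<^sub>R x + u) \<partial>lborel \<partial>subspace_lborel (tangent_space x))"
proof -
  let ?B = "some_onb (tangent_space x)"
  let ?s = "\<lambda>f. \<Sum>b\<in>?B. f b *\<^sub>R b"
  note xB = orthonormal_basis_insert_tangent[OF x]
  have fin: "finite ?B"
    by (rule orthonormal_basisD[OF some_onb[OF subspace_tangent_space]])
  interpret L: product_sigma_finite "\<lambda>_::'a. lborel :: real measure" ..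
  have upd: "(\<Sum>b\<in>insert x ?B. (f(x := t)) b *\<^sub>R b) = t *\<^sub>R x + ?s f" for f :: "'a \<Rightarrow> real" and t
    using fin xB(1) by (auto intro!: sum.cong)
  have F: "(\<integral>\<^sup>+v. F v \<partial>lborel) = (\<integral>\<^sup>+f. F (\<Sum>b\<in>insert x ?B. f b *\<^sub>R b) \<partial>(\<Pi>\<^sub>M b\<in>insert x ?B. lborel))"
    by (subst lborel_eq_orthonormal_basis[OF xB(2)], rule nn_integral_distr) auto
  have meas: "(\<lambda>f. F (\<Sum>b\<in>insert x ?B. f b *\<^sub>R b)) \<in> borel_measurable (\<Pi>\<^sub>M b\<in>insert x ?B. (lborel :: real measure))"
    by (intro measurable_compose[OF _ assms(2)] borel_measurable_sum borel_measurable_scaleR) auto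
  have "(\<integral>\<^sup>+v. F v \<partial>lborel) = (\<integral>\<^sup>+t. \<integral>\<^sup>+f. F (t *\<^sub>R x + ?s f) \<partial>(\<Pi>\<^sub>M b\<in>?B. lborel) \<partial>lborel)"
    unfolding F by (subst L.product_nn_integral_insert_rev[OF fin xB(1) meas]) (simp only: upd)
  also have "\<dots> = (\<integral>\<^sup>+t. \<integral>\<^sup>+u. F (t *\<^sub>R x + u) \<partial>subspace_lborel (tangent_space x) \<partial>lborel)"
    by (intro nn_integral_cong nn_integral_subspace_lborel[symmetric] subspace_tangent_space) measurable
  finally show "(\<integral>\<^sup>+v. F v \<partial>lborel) = (\<integral>\<^sup>+t. \<integral>\<^sup>+u. F (t *\<^sub>R x + u) \<partial>subspace_lborel (tangent_space x) \<partial>lborel)" .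
  have "(\<integral>\<^sup>+v. F v \<partial>lborel) = (\<integral>\<^sup>+f. \<integral>\<^sup>+t. F (t *\<^sub>R x + ?s f) \<partial>lborel \<partial>(\<Pi>\<^sub>M b\<in>?B. lborel))"
    unfolding F by (subst L.product_nn_integral_insert[OF fin xB(1) meas]) (simp only: upd)
  also have "\<dots> = (\<integral>\<^sup>+u. \<integral>\<^sup>+t. F (t *\<^sub>R x + u) \<partial>lborel \<partial>subspace_lborel (tangent_space x))"
    by (intro nn_integral_subspace_lborel[symmetric] subspace_tangent_space) measurable
  finally show "(\<integral>\<^sup>+v. F v \<partial>lborel) = (\<integral>\<^sup>+u. \<integral>\<^sup>+t. F (t *\<^sub>R x + u) \<partial>lborel \<partial>subspace_lborel (tangent_space x))" .
qed

text \<open>Writing integrals over \<open>x\<^sup>\<bottom>\<close> as integrals over the ambient space makes their measurability in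
  \<open>x\<close> and their rotation invariance evident; the choice of basis in \<^const>\<open>subspace_lborel\<close> hides both.\<close>

lemma nn_integral_tangent_eq_lborel:
  fixes G :: "'a::euclidean_space \<Rightarrow> ennreal"
  assumes x: "x \<in> sphere 0 1" and [measurable]: "G \<in> borel_measurable borel"
  shows "(\<integral>\<^sup>+u. G u \<partial>subspace_lborel (tangent_space x)) =
    (\<integral>\<^sup>+v. indicator {0..1} (v \<bullet> x) * G (v - (v \<bullet> x) *\<^sub>R x) \<partial>lborel)"
proof -
  have xx: "x \<bullet> x = 1" using x by (simp add: dot_square_norm)
  have "(\<integral>\<^sup>+v. indicator {0..1} (v \<bullet> x) * G (v - (v \<bullet> x) *\<^sub>R x) \<partial>lborel) =
    (\<integral>\<^sup>+t. \<integral>\<^sup>+u. indicator {0..1} ((t *\<^sub>R x + u) \<bullet> x) * G (t *\<^sub>R x + u - ((t *\<^sub>R x + u) \<bullet> x) *\<^sub>R x)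
        \<partial>subspace_lborel (tangent_space x) \<partial>lborel)"
    by (rule nn_integral_lborel_tangent[OF x]) measurable
  also have "\<dots> = (\<integral>\<^sup>+t. \<integral>\<^sup>+u. indicator {0..1::real} t * G u \<partial>subspace_lborel (tangent_space x) \<partial>lborel)"
  proof (intro nn_integral_cong)
    fix t u assume "u \<in> space (subspace_lborel (tangent_space x))"
    then have "u \<bullet> x = 0" by (simp add: tangent_space_def orthogonal_def inner_commute)
    then have "(t *\<^sub>R x + u) \<bullet> x = t" by (simp add: inner_add_left xx)
    then show "indicator {0..1} ((t *\<^sub>R x + u) \<bullet> x) * G (t *\<^sub>R x + u - ((t *\<^sub>R x + u) \<bullet> x) *\<^sub>R x) =
        indicator {0..1::real} t * G u" by simp
  qed
  also have "\<dots> = (\<integral>\<^sup>+t. indicator {0..1::real} t * (\<integral>\<^sup>+u. G u \<partial>subspace_lborel (tangent_space x)) \<partial>lborel)"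
    by (intro nn_integral_cong nn_integral_cmult borel_measurable_subspace_lborel) measurable
  also have "\<dots> = (\<integral>\<^sup>+u. G u \<partial>subspace_lborel (tangent_space x))"
    \<comment> \<open>The slab \<open>0 \<le> v \<bullet> x \<le> 1\<close> has thickness 1, so
      integrating over \<open>t\<close> contributes the factor 1.\<close>
    by (subst nn_integral_multc) auto
  finally show ?thesis by simp
qed

text \<open>Scaling in the ambient space gives \<open>c ^ DIM('a)\<close>. It also changes the
  thickness of the slab to \<open>1 / c\<close>, which lowers the exponent by one.\<close>

lemma nn_integral_tangent_scaleR:
  fixes G :: "'a::euclidean_space \<Rightarrow> ennreal"
  assumes x: "x \<in> sphere 0 1" and [measurable]: "G \<in> borel_measurable borel" and c: "c > 0"
  shows "(\<integral>\<^sup>+u. G u \<partial>subspace_lborel (tangent_space x)) =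
    ennreal (c ^ (DIM('a) - 1)) * (\<integral>\<^sup>+u. G (c *\<^sub>R u) \<partial>subspace_lborel (tangent_space x))"
proof -
  let ?W = "subspace_lborel (tangent_space x)"
  have xx: "x \<bullet> x = 1" using x by (simp add: dot_square_norm)
  define F where "F v = indicator {0..1} (v \<bullet> x) * G (v - (v \<bullet> x) *\<^sub>R x)" for v
  have [measurable]: "F \<in> borel_measurable borel" unfolding F_def by measurable
  have "(\<integral>\<^sup>+v. F (c *\<^sub>R v) \<partial>lborel) = (\<integral>\<^sup>+t. \<integral>\<^sup>+u. F (c *\<^sub>R (t *\<^sub>R x + u)) \<partial>?W \<partial>lborel)"
    by (rule nn_integral_lborel_tangent[OF x]) measurable
  also have "\<dots> = (\<integral>\<^sup>+t. \<integral>\<^sup>+u. indicator {0..1/c} t * G (c *\<^sub>R u) \<partial>?W \<partial>lborel)"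
  proof (intro nn_integral_cong)
    fix t u assume "u \<in> space ?W"
    then have "u \<bullet> x = 0" by (simp add: tangent_space_def orthogonal_def inner_commute)
    then have "c *\<^sub>R (t *\<^sub>R x + u) \<bullet> x = c * t" by (simp add: inner_add_left xx)
    moreover have "indicator {0..1} (c * t) = (indicator {0..1/c} t :: ennreal)"
      using c by (auto simp: indicator_def field_simps zero_le_mult_iff)
    ultimately show "F (c *\<^sub>R (t *\<^sub>R x + u)) = indicator {0..1/c} t * G (c *\<^sub>R u)"
      by (simp add: F_def scaleR_add_right)
  qed
  also have "\<dots> = (\<integral>\<^sup>+t. indicator {0..1/c} t * (\<integral>\<^sup>+u. G (c *\<^sub>R u) \<partial>?W) \<partial>lborel)"
    by (intro nn_integral_cong nn_integral_cmult borel_measurable_subspace_lborel) measurable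
  also have "\<dots> = ennreal (1/c) * (\<integral>\<^sup>+u. G (c *\<^sub>R u) \<partial>?W)"
    using c by (subst nn_integral_multc) auto
  finally have "(\<integral>\<^sup>+u. G u \<partial>?W) = ennreal (c ^ DIM('a)) * (ennreal (1/c) * (\<integral>\<^sup>+u. G (c *\<^sub>R u) \<partial>?W))"
    using nn_integral_tangent_eq_lborel[OF x assms(2)] nn_integral_lborel_scaleR[of F, OF _ c] by (simp add: F_def)
  also have "\<dots> = ennreal (c ^ DIM('a) * (1/c)) * (\<integral>\<^sup>+u. G (c *\<^sub>R u) \<partial>?W)"
    using c by (simp add: ennreal_mult mult.assoc del: times_divide_eq_right)
  also have "c ^ DIM('a) * (1/c) = c ^ (DIM('a) - 1)"
    using c DIM_positive[where 'a='a] by (cases "DIM('a)") auto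
  finally show ?thesis .
qed

section \<open>Integrals against the surface measure of a unit sphere\<close>

lemma sgn_measurable_euclidean [measurable]: "sgn \<in> borel \<rightarrow>\<^sub>M (borel :: 'a::euclidean_space measure)"
  unfolding sgn_div_norm by measurable

lemma space_unit_sphere_measure [simp]: "space (unit_sphere_measure V) = sphere 0 1 \<inter> V"
  by (simp add: unit_sphere_measure_def space_restrict_space space_scale_measure)

lemma sets_unit_sphere_measure: "sets (unit_sphere_measure V) = sets (restrict_space borel (sphere 0 1 \<inter> V))"
  by (simp add: unit_sphere_measure_def)

lemma borel_measurable_unit_sphere_measure:
  "f \<in> borel \<rightarrow>\<^sub>M M \<Longrightarrow> f \<in> unit_sphere_measure V \<rightarrow>\<^sub>M M"
  by (simp add: measurable_cong_sets[OF sets_unit_sphere_measure refl] measurable_restrict_space1)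

lemma nn_integral_unit_sphere_measure:
  fixes V :: "'a::euclidean_space set"
  assumes V: "subspace V" and [measurable]: "f \<in> borel_measurable borel"
  shows "(\<integral>\<^sup>+w. f w \<partial>unit_sphere_measure V) =
    of_nat (dim V) * (\<integral>\<^sup>+u. indicator (ball 0 1 - {0}) u * f (sgn u) \<partial>subspace_lborel V)"
proof -
  let ?D = "ball 0 1 - {0} :: 'a set"
  have sgn_meas: "sgn \<in> restrict_space (subspace_lborel V) ?D \<rightarrow>\<^sub>M restrict_space borel (sphere 0 1 \<inter> V)"
  proof (rule measurable_restrict_space2)
    show "sgn \<in> space (restrict_space (subspace_lborel V) ?D) \<rightarrow> sphere 0 1 \<inter> V"
      using V by (auto simp: space_restrict_space norm_sgn sgn_div_norm subspace_scale)
    show "sgn \<in> restrict_space (subspace_lborel V) ?D \<rightarrow>\<^sub>M borel"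
      by (intro measurable_restrict_space1 borel_measurable_subspace_lborel sgn_measurable_euclidean)
  qed
  have D: "?D \<inter> space (subspace_lborel V) \<in> sets (subspace_lborel V)"
    unfolding sets_subspace_lborel sets_restrict_space space_subspace_lborel
    by (rule image_eqI[of _ _ ?D]) auto
  have "(\<integral>\<^sup>+w. f w \<partial>unit_sphere_measure V) = of_nat (dim V) * (\<integral>\<^sup>+u. f (sgn u) \<partial>restrict_space (subspace_lborel V) ?D)"
    unfolding unit_sphere_measure_def
    by (subst nn_integral_scale_measure, simp add: measurable_restrict_space1)
       (subst nn_integral_distr[OF sgn_meas], simp_all add: measurable_restrict_space1)
  also have "(\<integral>\<^sup>+u. f (sgn u) \<partial>restrict_space (subspace_lborel V) ?D) =
      (\<integral>\<^sup>+u. indicator (ball 0 1 - {0}) u * f (sgn u) \<partial>subspace_lborel V)"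
    by (subst nn_integral_restrict_space[OF D]) (simp add: mult.commute)
  finally show ?thesis .
qed

subsection \<open>Polar coordinates on the sphere\<close>

text \<open>The value is \<open>1 + 1 / m\<close>, from \<open>\<tau> < 1\<close> and the tail. In
  dimension \<open>m + 1\<close> the integrand compares the volume of
  \<open>{v. norm v < 1 \<and> \<tau> < 1 / norm v}\<close> with that of the unit ball, so this is
  the ratio between the weights \<open>1 / norm v\<close> and 1.\<close>

lemma nn_integral_min_inverse_power:
  assumes m: "m > 0"
  shows "(\<integral>\<^sup>+\<tau>. indicator {0<..} \<tau> * ennreal (min 1 (1 / \<tau>) ^ Suc m) \<partial>lborel) = ennreal (real (Suc m) / real m)"
proof -
  have "(\<integral>\<^sup>+\<tau>. indicator {0<..} \<tau> * ennreal (min 1 (1 / \<tau>) ^ Suc m) \<partial>lborel) =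
    (\<integral>\<^sup>+\<tau>. indicator {0<..<1} \<tau> + ennreal (1 / \<tau> ^ Suc m) * indicator {1..} \<tau> \<partial>lborel)"
  proof (rule nn_integral_cong)
    fix \<tau> :: real
    show "indicator {0<..} \<tau> * ennreal (min 1 (1 / \<tau>) ^ Suc m) =
        indicator {0<..<1} \<tau> + ennreal (1 / \<tau> ^ Suc m) * indicator {1..} \<tau>"
      by (cases "\<tau> < 1") (auto simp: indicator_def min_def power_one_over field_simps)
  qed
  also have "\<dots> = (\<integral>\<^sup>+\<tau>. indicator {0<..<1::real} \<tau> \<partial>lborel) + (\<integral>\<^sup>+\<tau>. ennreal (1 / \<tau> ^ Suc m) * indicator {1..} \<tau> \<partial>lborel)"
    by (rule nn_integral_add) auto
  also have "(\<integral>\<^sup>+\<tau>. indicator {0<..<1::real} \<tau> \<partial>lborel) = 1"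
    by simp
  also have "(\<integral>\<^sup>+\<tau>. ennreal (1 / \<tau> ^ Suc m) * indicator {1..} \<tau> \<partial>lborel) = ennreal (0 - (- (1 / (real m * 1 ^ m))))"
  proof (rule nn_integral_FTC_atLeast[where F="\<lambda>\<tau>. - (1 / (real m * \<tau> ^ m))"])
    show "((\<lambda>\<tau>. - (1 / (real m * \<tau> ^ m))) has_real_derivative 1 / x ^ Suc m) (at x)" if "1 \<le> x" for x
    proof -
      obtain k where k: "m = Suc k" using m by (cases m) auto
      show ?thesis
        by (rule derivative_eq_intros refl | (use that m in simp; fail))+
           (use that in \<open>simp add: k field_simps del: of_nat_Suc\<close>)
    qed
    have "((\<lambda>\<tau>::real. - (1 / real m * inverse \<tau> ^ m)) \<longlongrightarrow> - (1 / real m * 0 ^ m)) at_top"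
      by (intro tendsto_intros tendsto_inverse_0_at_top filterlim_ident)
    then show "((\<lambda>\<tau>::real. - (1 / (real m * \<tau> ^ m))) \<longlongrightarrow> 0) at_top"
      using m by (simp add: field_simps power_0_left)
  qed auto
  finally show ?thesis
    using m by (simp add: field_simps flip: ennreal_plus ennreal_1)
qed

text \<open>Radial weights only change integrals of degree-0 homogeneous functions by a constant. The
  weight \<open>1 / |v|\<close> is a superposition of indicators of balls, so scaling gives the constant.\<close>

lemma nn_integral_ball_inverse_norm:
  fixes f :: "'a::euclidean_space \<Rightarrow> ennreal"
  assumes N: "DIM('a) \<ge> 2" and [measurable]: "f \<in> borel_measurable borel"
  shows "of_nat DIM('a) * (\<integral>\<^sup>+v. indicator (ball 0 1 - {0}) v * f (sgn v) \<partial>lborel) =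
    of_nat (DIM('a) - 1) * (\<integral>\<^sup>+v. indicator (ball 0 1 - {0}) v * (ennreal (1 / norm v) * f (sgn v)) \<partial>lborel)"
proof -
  define m where "m = DIM('a) - 1"
  have m: "m > 0" "DIM('a) = Suc m" using N by (auto simp: m_def)
  let ?G = "\<integral>\<^sup>+v. indicator (ball 0 1 - {0}) v * f (sgn v) \<partial>lborel"
  \<comment> \<open>For fixed \<open>v\<close> in the punctured ball, \<open>\<tau>\<close> runs
    through an interval of length \<open>1 / norm v\<close>; for fixed \<open>\<tau>\<close>,
    \<open>v\<close> runs through a punctured ball of radius
    \<open>min 1 (1 / \<tau>)\<close>.\<close>
  define g where "g \<tau> v = (if 0 < \<tau> \<and> v \<noteq> 0 \<and> norm v < min 1 (1 / \<tau>) then f (sgn v) else 0)" for \<tau> :: real and v :: 'a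
  have [measurable]: "case_prod g \<in> borel_measurable (lborel \<Otimes>\<^sub>M lborel)"
    unfolding g_def by measurable
  have "(\<integral>\<^sup>+v. indicator (ball 0 1 - {0}) v * (ennreal (1 / norm v) * f (sgn v)) \<partial>lborel) =
      (\<integral>\<^sup>+v. \<integral>\<^sup>+\<tau>. g \<tau> v \<partial>lborel \<partial>lborel)"
  proof (rule nn_integral_cong)
    fix v :: 'a
    show "indicator (ball 0 1 - {0}) v * (ennreal (1 / norm v) * f (sgn v)) = (\<integral>\<^sup>+\<tau>. g \<tau> v \<partial>lborel)"
    proof (cases "v \<in> ball 0 1 - {0}")
      case True
      then have "g \<tau> v = indicator {0<..<1 / norm v} \<tau> * f (sgn v)" for \<tau>
        by (auto simp: g_def field_simps)
      then show ?thesis using True by (simp add: nn_integral_multc)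
    next
      case False
      then have "g \<tau> v = 0" for \<tau> by (auto simp: g_def)
      then show ?thesis using False by simp
    qed
  qed
  also have "\<dots> = (\<integral>\<^sup>+\<tau>. \<integral>\<^sup>+v. g \<tau> v \<partial>lborel \<partial>lborel)"
    by (rule lborel_pair.Fubini') measurable
  also have "\<dots> = (\<integral>\<^sup>+\<tau>. indicator {0<..} \<tau> * ennreal (min 1 (1 / \<tau>) ^ Suc m) * ?G \<partial>lborel)"
  proof (rule nn_integral_cong)
    fix \<tau> :: real
    show "(\<integral>\<^sup>+v. g \<tau> v \<partial>lborel) = indicator {0<..} \<tau> * ennreal (min 1 (1 / \<tau>) ^ Suc m) * ?G"
    proof (cases "\<tau> > 0")
      case True
      define c where "c = min 1 (1 / \<tau>)"
      have c: "c > 0" using True by (simp add: c_def)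
      have "(\<integral>\<^sup>+v. g \<tau> v \<partial>lborel) = ennreal (c ^ DIM('a)) * (\<integral>\<^sup>+v. g \<tau> (c *\<^sub>R v) \<partial>lborel)"
        using c by (intro nn_integral_lborel_scaleR) measurable
      also have "(\<integral>\<^sup>+v. g \<tau> (c *\<^sub>R v) \<partial>lborel) = ?G"
        using c True by (intro nn_integral_cong) (auto simp: g_def sgn_scaleR indicator_def simp flip: c_def)
      finally show ?thesis using True by (simp add: c_def m)
    qed (simp add: g_def)
  qed
  also have "\<dots> = ennreal (real (Suc m) / real m) * ?G"
    by (subst nn_integral_multc) (measurable, simp only: nn_integral_min_inverse_power[OF m(1)])
  finally have "of_nat m * (\<integral>\<^sup>+v. indicator (ball 0 1 - {0}) v * (ennreal (1 / norm v) * f (sgn v)) \<partial>lborel) =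
      ennreal (real m * (real (Suc m) / real m)) * ?G"
    by (simp add: ennreal_mult mult.assoc ennreal_of_nat_eq_real_of_nat del: of_nat_Suc times_divide_eq_right)
  then show ?thesis
    using m by (simp add: ennreal_of_nat_eq_real_of_nat del: of_nat_Suc)
qed

text \<open>The substitution is \<open>t = \<rho> cot r\<close>. The substitution rule used is for
  compact intervals and increasing maps, hence the exhaustion of the open interval and the detour
  through \<open>H (- t)\<close> with the increasing map \<open>- \<rho> cot r\<close>.\<close>

lemma nn_integral_substitution_cot:
  fixes H :: "real \<Rightarrow> ennreal"
  assumes [measurable]: "H \<in> borel_measurable borel" and \<rho>: "\<rho> > 0"
  shows "(\<integral>\<^sup>+t. H t \<partial>lborel) =
    (\<integral>\<^sup>+r. indicator {0<..<pi} r * (ennreal (\<rho> / (sin r)\<^sup>2) * H (\<rho> * cos r / sin r)) \<partial>lborel)"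
proof -
  \<comment> \<open>Chosen so that \<open>cot (a j) = j + 1\<close>; then
    \<open>[a j, pi - a j]\<close> is mapped exactly onto
    \<open>[- \<rho> (j + 1), \<rho> (j + 1)]\<close>.\<close>
  define a where "a j = arctan (1 / real (Suc j))" for j
  have a_pos: "0 < a j" and a_less: "a j < pi / 2" for j
    unfolding a_def using arctan_ubound[of "1 / real (Suc j)"] by simp_all
  have cot_a: "cos (a j) / sin (a j) = real (Suc j)" for j
  proof -
    have "sin (a j) > 0" using a_pos[of j] a_less[of j] by (intro sin_gt_zero) auto
    then show ?thesis
      using tan_arctan[of "1 / real (Suc j)"] unfolding a_def[symmetric] tan_def
      by (auto simp: field_simps split: if_splits)
  qed
  have a_dec: "a (Suc j) \<le> a j" for j
    unfolding a_def by (intro arctan_monotone') (simp add: field_simps)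
  have a_lim: "a \<longlonglongrightarrow> 0"
  proof -
    have "(\<lambda>j. arctan (1 / real (Suc j))) \<longlonglongrightarrow> arctan 0"
      by (intro tendsto_arctan LIMSEQ_Suc[OF lim_1_over_n])
    then show ?thesis by (simp add: a_def[abs_def])
  qed
  let ?c = "\<lambda>j. \<rho> * real (Suc j)"
  have sub: "(\<integral>\<^sup>+t. H (- t) * indicator {- ?c j .. ?c j} t \<partial>lborel) =
      (\<integral>\<^sup>+r. H (\<rho> * cos r / sin r) * ennreal (\<rho> / (sin r)\<^sup>2) * indicator {a j .. pi - a j} r \<partial>lborel)" for j
  proof -
    let ?g = "\<lambda>r. - \<rho> * cos r / sin r"
    have sin_pos: "sin r > 0" if "r \<in> {a j .. pi - a j}" for r
      using that a_pos[of j] by (intro sin_gt_zero) auto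
    have "\<rho> * cos (a j) / sin (a j) = ?c j"
      using cot_a[of j] by (metis times_divide_eq_right)
    then have ga: "?g (a j) = - ?c j" and gb: "?g (pi - a j) = ?c j"
      by simp_all
    have "(\<integral>\<^sup>+t. H (- t) * indicator {?g (a j) .. ?g (pi - a j)} t \<partial>lborel) =
        (\<integral>\<^sup>+r. H (- ?g r) * ennreal (\<rho> / (sin r)\<^sup>2) * indicator {a j .. pi - a j} r \<partial>lborel)"
    proof (rule nn_integral_substitution_aux[where f="\<lambda>t. H (- t)" and g="?g" and g'="\<lambda>r. \<rho> / (sin r)\<^sup>2"])
      fix r assume r: "r \<in> {a j .. pi - a j}"
      have "((\<lambda>r. - \<rho> * cos r / sin r) has_real_derivative
          ((\<rho> * sin r) * sin r - (- \<rho> * cos r) * cos r) / (sin r * sin r)) (at r)"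
        using sin_pos[OF r] by (auto intro!: derivative_eq_intros simp: field_simps)
      also have "((\<rho> * sin r) * sin r - (- \<rho> * cos r) * cos r) = \<rho> * ((sin r)\<^sup>2 + (cos r)\<^sup>2)"
        by (simp add: power2_eq_square distrib_left del: sin_cos_squared_add sin_cos_squared_add2 sin_cos_squared_add3)
      also have "(sin r)\<^sup>2 + (cos r)\<^sup>2 = 1" by simp
      finally show "(?g has_real_derivative \<rho> / (sin r)\<^sup>2) (at r)"
        by (simp add: power2_eq_square)
    next
      show "continuous_on {a j .. pi - a j} (\<lambda>r. \<rho> / (sin r)\<^sup>2)"
        using sin_pos by (intro continuous_intros) force
    qed (use \<rho> a_less[of j] in auto)
    then show ?thesis unfolding ga gb by simp
  qed
  have "(\<lambda>j. \<integral>\<^sup>+t. H (- t) * indicator {- ?c j .. ?c j} t \<partial>lborel) \<longlonglongrightarrow> (\<integral>\<^sup>+t. H (- t) \<partial>lborel)"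
  proof (rule nn_integral_LIMSEQ)
    show "incseq (\<lambda>j t. H (- t) * indicator {- ?c j .. ?c j} t)"
    proof (intro incseq_SucI le_funI mult_left_mono)
      fix j :: nat and t :: real
      have "?c j \<le> ?c (Suc j)" using \<rho> by simp
      then show "indicator {- ?c j .. ?c j} t \<le> (indicator {- ?c (Suc j) .. ?c (Suc j)} t :: ennreal)"
        by (auto simp: indicator_def simp del: of_nat_Suc)
    qed simp
    show "(\<lambda>j. H (- t) * indicator {- ?c j .. ?c j} t) \<longlonglongrightarrow> H (- t)" for t
    proof (rule tendsto_eventually)
      obtain J where J: "\<bar>t\<bar> / \<rho> \<le> real J" using real_arch_simple by blast
      show "eventually (\<lambda>j. H (- t) * indicator {- ?c j .. ?c j} t = H (- t)) sequentially"
      proof (rule eventually_sequentiallyI)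
        fix j assume "J \<le> j"
        then have "\<bar>t\<bar> / \<rho> \<le> real (Suc j)" using J by linarith
        then have "\<bar>t\<bar> \<le> ?c j" using \<rho> by (simp add: field_simps)
        then show "H (- t) * indicator {- ?c j .. ?c j} t = H (- t)" by (auto simp: indicator_def)
      qed
    qed
  qed measurable
  moreover have "(\<lambda>j. \<integral>\<^sup>+r. H (\<rho> * cos r / sin r) * ennreal (\<rho> / (sin r)\<^sup>2) * indicator {a j .. pi - a j} r \<partial>lborel)
      \<longlonglongrightarrow> (\<integral>\<^sup>+r. H (\<rho> * cos r / sin r) * ennreal (\<rho> / (sin r)\<^sup>2) * indicator {0<..<pi} r \<partial>lborel)"
  proof (rule nn_integral_LIMSEQ)
    show "incseq (\<lambda>j r. H (\<rho> * cos r / sin r) * ennreal (\<rho> / (sin r)\<^sup>2) * indicator {a j .. pi - a j} r)"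
    proof (intro incseq_SucI le_funI mult_left_mono)
      fix j r show "indicator {a j .. pi - a j} r \<le> (indicator {a (Suc j) .. pi - a (Suc j)} r :: ennreal)"
        using a_dec[of j] by (auto simp: indicator_def)
    qed simp
    fix r :: real
    show "(\<lambda>j. H (\<rho> * cos r / sin r) * ennreal (\<rho> / (sin r)\<^sup>2) * indicator {a j .. pi - a j} r) \<longlonglongrightarrow>
        H (\<rho> * cos r / sin r) * ennreal (\<rho> / (sin r)\<^sup>2) * indicator {0<..<pi} r"
    proof (rule tendsto_eventually)
      show "eventually (\<lambda>j. H (\<rho> * cos r / sin r) * ennreal (\<rho> / (sin r)\<^sup>2) * indicator {a j .. pi - a j} r =
          H (\<rho> * cos r / sin r) * ennreal (\<rho> / (sin r)\<^sup>2) * indicator {0<..<pi} r) sequentially"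
      proof (cases "0 < r \<and> r < pi")
        case True
        then have "eventually (\<lambda>j. a j < min r (pi - r)) sequentially"
          by (intro order_tendstoD(2)[OF a_lim]) auto
        then show ?thesis
          by eventually_elim (use True in \<open>auto simp: indicator_def\<close>)
      next
        case False
        then have "r \<notin> {a j .. pi - a j}" for j using a_pos[of j] by auto
        then show ?thesis using False by auto
      qed
    qed
  qed measurable
  ultimately have "(\<integral>\<^sup>+t. H (- t) \<partial>lborel) =
      (\<integral>\<^sup>+r. H (\<rho> * cos r / sin r) * ennreal (\<rho> / (sin r)\<^sup>2) * indicator {0<..<pi} r \<partial>lborel)"
    unfolding sub by (rule LIMSEQ_unique)
  moreover have "(\<integral>\<^sup>+t. H (- t) \<partial>lborel) = (\<integral>\<^sup>+t. H t \<partial>lborel)"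
    using nn_integral_real_affine[of H "-1" 0] by simp
  ultimately show ?thesis by (simp add: mult_ac)
qed

text \<open>The exchange takes place between two copies of Lebesgue measure after the tangent
  integral has been rewritten over the ambient space, so sigma-finiteness of
  \<open>subspace_lborel\<close> does not have to be established.\<close>

lemma nn_integral_tangent_Fubini:
  fixes H :: "'b::euclidean_space \<Rightarrow> 'a::euclidean_space \<Rightarrow> ennreal"
  assumes x: "x \<in> sphere 0 1" and [measurable]: "case_prod H \<in> borel_measurable (borel \<Otimes>\<^sub>M borel)"
  shows "(\<integral>\<^sup>+u. \<integral>\<^sup>+r. H r u \<partial>lborel \<partial>subspace_lborel (tangent_space x)) =
    (\<integral>\<^sup>+r. \<integral>\<^sup>+u. H r u \<partial>subspace_lborel (tangent_space x) \<partial>lborel)"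
proof -
  have "(\<integral>\<^sup>+u. \<integral>\<^sup>+r. H r u \<partial>lborel \<partial>subspace_lborel (tangent_space x)) =
      (\<integral>\<^sup>+v. indicator {0..1} (v \<bullet> x) * (\<integral>\<^sup>+r. H r (v - (v \<bullet> x) *\<^sub>R x) \<partial>lborel) \<partial>lborel)"
    by (rule nn_integral_tangent_eq_lborel[OF x]) measurable
  also have "\<dots> = (\<integral>\<^sup>+v. \<integral>\<^sup>+r. indicator {0..1} (v \<bullet> x) * H r (v - (v \<bullet> x) *\<^sub>R x) \<partial>lborel \<partial>lborel)"
    by (intro nn_integral_cong nn_integral_cmult[symmetric]) measurable
  also have "\<dots> = (\<integral>\<^sup>+r. \<integral>\<^sup>+v. indicator {0..1} (v \<bullet> x) * H r (v - (v \<bullet> x) *\<^sub>R x) \<partial>lborel \<partial>lborel)"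
    by (rule lborel_pair.Fubini') measurable
  also have "\<dots> = (\<integral>\<^sup>+r. \<integral>\<^sup>+u. H r u \<partial>subspace_lborel (tangent_space x) \<partial>lborel)"
    by (intro nn_integral_cong nn_integral_tangent_eq_lborel[symmetric] x) measurable
  finally show ?thesis .
qed

lemma tangent_space_unit_vector:
  fixes x :: "'a::euclidean_space"
  assumes x: "x \<in> sphere 0 1" and N: "DIM('a) \<ge> 2"
  obtains w where "norm w = 1" "w \<in> tangent_space x"
proof -
  have B: "orthonormal_basis (tangent_space x) (some_onb (tangent_space x))"
    by (rule some_onb[OF subspace_tangent_space])
  have "card (some_onb (tangent_space x)) \<noteq> 0"
    using orthonormal_basisD(2)[OF B] dim_tangent_space[OF x] N by simp
  then obtain b where "b \<in> some_onb (tangent_space x)" by (metis card.empty ex_in_conv)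
  then show ?thesis using B that by (auto simp: orthonormal_basis_def)
qed

text \<open>The line through \<open>x\<close> lies in the hyperplane orthogonal to a unit tangent
  vector \<open>b\<close>, and hyperplanes are null. In dimension 1 the line would be
  everything.\<close>

lemma AE_lborel_proj_nonzero:
  fixes x :: "'a::euclidean_space"
  assumes x: "x \<in> sphere 0 1" and N: "DIM('a) \<ge> 2"
  shows "AE v in lborel. v - (v \<bullet> x) *\<^sub>R x \<noteq> 0"
proof -
  obtain b where "norm b = 1" "b \<in> tangent_space x" by (rule tangent_space_unit_vector[OF x N])
  then have b: "x \<bullet> b = 0" "b \<noteq> 0"
    by (auto simp: tangent_space_def orthogonal_def)
  have "{v. b \<bullet> v = 0} \<in> null_sets lebesgue"
    using negligible_hyperplane[of b 0] b by (simp add: negligible_iff_null_sets)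
  then have "AE v in lborel. v \<notin> {v. b \<bullet> v = 0}"
    using AE_not_in AE_completion_iff by blast
  then show ?thesis
  proof eventually_elim
    case (elim v)
    then show ?case
    proof (rule contrapos_nn)
      assume "v - (v \<bullet> x) *\<^sub>R x = 0"
      then have "b \<bullet> v = b \<bullet> ((v \<bullet> x) *\<^sub>R x)" by simp
      then show "v \<in> {v. b \<bullet> v = 0}" using b by (simp add: inner_commute)
    qed
  qed
qed

lemma norm_cos_sin:
  fixes x w :: "'a::real_inner"
  assumes "norm x = 1" "norm w = 1" "x \<bullet> w = 0"
  shows "norm (cos r *\<^sub>R x + sin r *\<^sub>R w) = 1"
proof -
  have "(cos r *\<^sub>R x + sin r *\<^sub>R w) \<bullet> (cos r *\<^sub>R x + sin r *\<^sub>R w) = (cos r)\<^sup>2 + (sin r)\<^sup>2"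
    using assms by (simp add: inner_add_left inner_add_right inner_commute norm_eq_1 power2_eq_square del: sin_cos_squared_add sin_cos_squared_add2)
  then show ?thesis by (simp add: norm_eq_1)
qed

text \<open>The power of the sine is assembled as follows. The Jacobian
  \<open>norm u / (sin r)\<^sup>2\<close> times the weight
  \<open>1 / norm v = sin r / norm u\<close> leaves \<open>1 / sin r\<close>; rescaling
  \<open>u\<close> by \<open>sin r\<close> in the tangent space contributes
  \<open>sin r ^ (DIM('a) - 1)\<close>. What remains of the \<open>u\<close>-integral is the cone
  integral that defines the measure on the tangent sphere.\<close>

lemma nn_integral_sphere_polar:
  fixes f :: "'a::euclidean_space \<Rightarrow> ennreal"
  assumes x: "x \<in> sphere 0 1" and N: "DIM('a) \<ge> 2" and [measurable]: "f \<in> borel_measurable borel"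
  shows "(\<integral>\<^sup>+z. f z \<partial>unit_sphere_measure UNIV) =
    (\<integral>\<^sup>+r. indicator {0<..<pi} r * (ennreal (sin r ^ (DIM('a) - 2)) *
      (\<integral>\<^sup>+w. f (cos r *\<^sub>R x + sin r *\<^sub>R w) \<partial>unit_sphere_measure (tangent_space x))) \<partial>lborel)"
proof -
  let ?W = "subspace_lborel (tangent_space x)"
  define m where "m = DIM('a) - 2"
  have m: "DIM('a) - 1 = Suc m" "DIM('a) - 2 = m" "DIM('a) - Suc 0 = Suc m" using N by (auto simp: m_def)
  have xx: "x \<bullet> x = 1" using x by (simp add: dot_square_norm)
  define e where "e r u = cos r *\<^sub>R x + sin r *\<^sub>R sgn u" for r and u :: 'a
  define F where "F v = indicator (ball 0 1 - {0}) v * (ennreal (1 / norm v) * f (sgn v))" for v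
  \<comment> \<open>\<open>norm u < sin r\<close> is the condition \<open>norm v < 1\<close> for
    \<open>v = (norm u / sin r) *\<^sub>R e r u\<close>.\<close>
  define G where "G r u = (if u \<noteq> 0 \<and> norm u < sin r then f (e r u) else 0)" for r and u :: 'a
  define H where "H r u = indicator {0<..<pi} r * (ennreal (1 / sin r) * G r u)" for r and u :: 'a
  have [measurable]: "ball 0 1 - {0} \<in> sets (borel :: 'a measure)" by auto
  have [measurable]: "F \<in> borel_measurable borel" unfolding F_def by measurable
  have [measurable]: "case_prod G \<in> borel_measurable (borel \<Otimes>\<^sub>M borel)" unfolding G_def e_def by measurable
  have H_meas: "case_prod H \<in> borel_measurable (borel \<Otimes>\<^sub>M borel)" unfolding H_def by measurable
  have radial: "(\<integral>\<^sup>+t. F (t *\<^sub>R x + u) \<partial>lborel) = (\<integral>\<^sup>+r. H r u \<partial>lborel)"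
    if u: "u \<in> tangent_space x" "u \<noteq> 0" for u
  proof -
    have xu: "x \<bullet> u = 0" using u by (simp add: tangent_space_def orthogonal_def)
    have "(\<integral>\<^sup>+t. F (t *\<^sub>R x + u) \<partial>lborel) = (\<integral>\<^sup>+r. indicator {0<..<pi} r *
        (ennreal (norm u / (sin r)\<^sup>2) * F ((norm u * cos r / sin r) *\<^sub>R x + u)) \<partial>lborel)"
      using u by (intro nn_integral_substitution_cot) auto
    also have "\<dots> = (\<integral>\<^sup>+r. H r u \<partial>lborel)"
    proof (rule nn_integral_cong)
      fix r :: real
      show "indicator {0<..<pi} r * (ennreal (norm u / (sin r)\<^sup>2) * F ((norm u * cos r / sin r) *\<^sub>R x + u)) = H r u"
      proof (cases "r \<in> {0<..<pi}")
        case True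
        then have s: "sin r > 0" by (intro sin_gt_zero) auto
        have e1: "norm (e r u) = 1"
          unfolding e_def using x u xu
          by (intro norm_cos_sin) (auto simp: norm_sgn, simp add: sgn_div_norm)
        have v: "(norm u * cos r / sin r) *\<^sub>R x + u = (norm u / sin r) *\<^sub>R e r u"
          using s u by (simp add: e_def scaleR_add_right sgn_div_norm)
        have nv: "norm ((norm u / sin r) *\<^sub>R e r u) = norm u / sin r" using s e1 by simp
        have sv: "sgn ((norm u / sin r) *\<^sub>R e r u) = e r u"
          using s u e1 by (simp add: sgn_scaleR) (simp add: sgn_div_norm)
        have "F ((norm u / sin r) *\<^sub>R e r u) = (if norm u < sin r then ennreal (sin r / norm u) * f (e r u) else 0)"
          unfolding F_def nv sv using s u e1 by (auto simp: indicator_def nv field_simps simp del: norm_scaleR)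
        moreover have "ennreal (norm u / (sin r)\<^sup>2) * (ennreal (sin r / norm u) * f (e r u)) = ennreal (1 / sin r) * f (e r u)"
          using s u by (simp add: mult.assoc[symmetric] ennreal_mult[symmetric] power2_eq_square)
        ultimately show ?thesis using True u unfolding v by (simp add: H_def G_def)
      qed (simp add: H_def)
    qed
    finally show ?thesis .
  qed
  have scale: "(\<integral>\<^sup>+u. H r u \<partial>?W) = indicator {0<..<pi} r * (ennreal (sin r ^ m) *
      (\<integral>\<^sup>+u. indicator (ball 0 1 - {0}) u * f (e r u) \<partial>?W))" for r
  proof (cases "r \<in> {0<..<pi}")
    case True
    then have s: "sin r > 0" by (intro sin_gt_zero) auto
    have G1: "G r (sin r *\<^sub>R u) = indicator (ball 0 1 - {0}) u * f (e r u)" for u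
      using s by (auto simp: G_def e_def sgn_scaleR indicator_def)
    have "(\<integral>\<^sup>+u. H r u \<partial>?W) = ennreal (1 / sin r) * (\<integral>\<^sup>+u. G r u \<partial>?W)"
      using True unfolding H_def by (simp add: nn_integral_cmult borel_measurable_subspace_lborel)
    also have "(\<integral>\<^sup>+u. G r u \<partial>?W) = ennreal (sin r ^ Suc m) * (\<integral>\<^sup>+u. G r (sin r *\<^sub>R u) \<partial>?W)"
      using nn_integral_tangent_scaleR[OF x _ s, of "G r"] by (simp add: m)
    also have "ennreal (1 / sin r) * (ennreal (sin r ^ Suc m) * I) = ennreal (sin r ^ m) * I" for I
      using s by (simp add: mult.assoc[symmetric] ennreal_mult[symmetric])
    finally show ?thesis using True by (simp add: G1)
  qed (simp add: H_def)
  have tan: "(\<integral>\<^sup>+w. f (cos r *\<^sub>R x + sin r *\<^sub>R w) \<partial>unit_sphere_measure (tangent_space x)) =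
      of_nat (Suc m) * (\<integral>\<^sup>+u. indicator (ball 0 1 - {0}) u * f (e r u) \<partial>?W)" for r
    using nn_integral_unit_sphere_measure[OF subspace_tangent_space[of x], of "\<lambda>w. f (cos r *\<^sub>R x + sin r *\<^sub>R w)"]
    by (simp add: dim_tangent_space[OF x] m e_def)
  have "(\<integral>\<^sup>+z. f z \<partial>unit_sphere_measure UNIV) = of_nat (Suc m) * (\<integral>\<^sup>+v. F v \<partial>lborel)"
    using nn_integral_unit_sphere_measure[OF subspace_UNIV, of f] nn_integral_ball_inverse_norm[OF N, of f]
    by (simp add: F_def m subspace_lborel_UNIV)
  \<comment> \<open>The substitution needs \<open>norm u > 0\<close>. The line spanned by
    \<open>x\<close>, where \<open>u = 0\<close>, is null, and the integrand is set to 0 there to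
    agree with \<open>H r 0 = 0\<close>.\<close>
  also have "(\<integral>\<^sup>+v. F v \<partial>lborel) = (\<integral>\<^sup>+v. (if v - (v \<bullet> x) *\<^sub>R x = 0 then 0 else F v) \<partial>lborel)"
    by (rule nn_integral_cong_AE) (use AE_lborel_proj_nonzero[OF x N] in auto)
  also have "\<dots> = (\<integral>\<^sup>+u. \<integral>\<^sup>+t. (if (t *\<^sub>R x + u) - ((t *\<^sub>R x + u) \<bullet> x) *\<^sub>R x = 0 then 0 else F (t *\<^sub>R x + u)) \<partial>lborel \<partial>?W)"
    by (rule nn_integral_lborel_tangent(2)[OF x]) measurable
  also have "\<dots> = (\<integral>\<^sup>+u. \<integral>\<^sup>+r. H r u \<partial>lborel \<partial>?W)"
  proof (rule nn_integral_cong)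
    fix u assume "u \<in> space ?W"
    then have u: "u \<in> tangent_space x" by simp
    then have "u \<bullet> x = 0" by (simp add: tangent_space_def orthogonal_def inner_commute)
    then have proj: "(t *\<^sub>R x + u) - ((t *\<^sub>R x + u) \<bullet> x) *\<^sub>R x = u" for t by (simp add: inner_add_left xx)
    have "H r 0 = 0" for r by (simp add: H_def G_def)
    then show "(\<integral>\<^sup>+t. (if (t *\<^sub>R x + u) - ((t *\<^sub>R x + u) \<bullet> x) *\<^sub>R x = 0 then 0 else F (t *\<^sub>R x + u)) \<partial>lborel) =
        (\<integral>\<^sup>+r. H r u \<partial>lborel)"
      unfolding proj using radial[OF u] by (cases "u = 0") simp_all
  qed
  also have "\<dots> = (\<integral>\<^sup>+r. \<integral>\<^sup>+u. H r u \<partial>?W \<partial>lborel)"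
    by (rule nn_integral_tangent_Fubini[OF x H_meas])
  also have "of_nat (Suc m) * \<dots> = (\<integral>\<^sup>+r. of_nat (Suc m) * (\<integral>\<^sup>+u. H r u \<partial>?W) \<partial>lborel)"
  proof (rule nn_integral_cmult[symmetric])
    note H_meas[measurable]
    show "(\<lambda>r. \<integral>\<^sup>+u. H r u \<partial>?W) \<in> borel_measurable lborel"
      by (subst nn_integral_tangent_eq_lborel[OF x]) measurable
  qed
  also have "\<dots> = (\<integral>\<^sup>+r. indicator {0<..<pi} r * (ennreal (sin r ^ m) *
      (\<integral>\<^sup>+w. f (cos r *\<^sub>R x + sin r *\<^sub>R w) \<partial>unit_sphere_measure (tangent_space x))) \<partial>lborel)"
    unfolding scale tan by (simp only: mult_ac)
  finally show ?thesis by (simp add: m)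
qed

subsection \<open>Rotation invariance\<close>

lemma emeasure_space_unit_sphere_measure:
  fixes V :: "'a::euclidean_space set"
  assumes "subspace V" "dim V = m + 1"
  shows "emeasure (unit_sphere_measure V) (space (unit_sphere_measure V)) = ennreal (sphere_area m)"
  using emeasure_unit_sphere_measure[OF assms] by simp

lemma finite_measure_unit_sphere_measure:
  fixes V :: "'a::euclidean_space set"
  assumes "subspace V" "dim V \<ge> 1"
  shows "finite_measure (unit_sphere_measure V)"
  using emeasure_space_unit_sphere_measure[of V "dim V - 1"] assms by (intro finite_measureI) simp

lemma sphere_area_pos: "sphere_area m > 0"
  unfolding sphere_area_def by (intro mult_pos_pos unit_ball_vol_pos) auto

lemma nn_integral_tangent_sphere:
  fixes g :: "'a::euclidean_space \<Rightarrow> ennreal"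
  assumes x: "x \<in> sphere 0 1" and [measurable]: "g \<in> borel_measurable borel"
  shows "(\<integral>\<^sup>+w. g w \<partial>unit_sphere_measure (tangent_space x)) =
    of_nat (DIM('a) - 1) * (\<integral>\<^sup>+v. indicator {0..1} (v \<bullet> x) *
      (indicator (ball 0 1 - {0}) (v - (v \<bullet> x) *\<^sub>R x) * g (sgn (v - (v \<bullet> x) *\<^sub>R x))) \<partial>lborel)"
proof -
  have [measurable]: "ball 0 1 - {0} \<in> sets (borel :: 'a measure)" by auto
  show ?thesis
    unfolding nn_integral_unit_sphere_measure[OF subspace_tangent_space assms(2)] dim_tangent_space[OF x]
    by (subst nn_integral_tangent_eq_lborel[OF x]) auto
qed

lemma borel_measurable_nn_integral_tangent_sphere:
  fixes h :: "'b \<times> 'a::euclidean_space \<Rightarrow> ennreal"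
  assumes [measurable]: "h \<in> borel_measurable (M \<Otimes>\<^sub>M borel)" "X \<in> M \<rightarrow>\<^sub>M borel"
    and X: "\<And>p. p \<in> space M \<Longrightarrow> X p \<in> sphere 0 1"
  shows "(\<lambda>p. \<integral>\<^sup>+w. h (p, w) \<partial>unit_sphere_measure (tangent_space (X p))) \<in> borel_measurable M"
proof -
  have [measurable]: "ball 0 1 - {0} \<in> sets (borel :: 'a measure)" by auto
  have "(\<lambda>p. of_nat (DIM('a) - 1) * (\<integral>\<^sup>+v. indicator {0..1} (v \<bullet> X p) *
      (indicator (ball 0 1 - {0}) (v - (v \<bullet> X p) *\<^sub>R X p) * h (p, sgn (v - (v \<bullet> X p) *\<^sub>R X p))) \<partial>lborel))
      \<in> borel_measurable M"
    by measurable
  then show ?thesis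
    by (rule measurable_cong[THEN iffD1, rotated]) (subst nn_integral_tangent_sphere[OF X], auto)
qed

lemma nn_integral_lborel_orthogonal_transformation:
  fixes F :: "'a::euclidean_space \<Rightarrow> ennreal" and T :: "'a \<Rightarrow> 'a"
  assumes T: "orthogonal_transformation T" and [measurable]: "F \<in> borel_measurable borel"
  shows "(\<integral>\<^sup>+v. F (T v) \<partial>lborel) = (\<integral>\<^sup>+v. F v \<partial>lborel)"
proof -
  note [measurable] = borel_measurable_orthogonal_transformation[OF T]
  show ?thesis
    by (subst (2) distr_lborel_orthogonal_transformation[OF T, symmetric]) (simp add: nn_integral_distr)
qed

lemma orthogonal_transformation_sgn:
  "orthogonal_transformation T \<Longrightarrow> T (sgn v) = sgn (T v)"
  by (simp add: sgn_div_norm orthogonal_transformation_scaleR orthogonal_transformation_norm)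

lemma orthogonal_transformation_eq_0_iff:
  "orthogonal_transformation T \<Longrightarrow> T v = 0 \<longleftrightarrow> v = 0"
  by (metis norm_eq_zero orthogonal_transformation_norm)

lemma nn_integral_sphere_orthogonal_transformation:
  fixes f :: "'a::euclidean_space \<Rightarrow> ennreal" and T :: "'a \<Rightarrow> 'a"
  assumes T: "orthogonal_transformation T" and [measurable]: "f \<in> borel_measurable borel"
  shows "(\<integral>\<^sup>+x. f (T x) \<partial>unit_sphere_measure UNIV) = (\<integral>\<^sup>+x. f x \<partial>unit_sphere_measure UNIV)"
proof -
  note [measurable] = borel_measurable_orthogonal_transformation[OF T]
  have [measurable]: "ball 0 1 - {0} \<in> sets (borel :: 'a measure)" by auto
  have "(\<integral>\<^sup>+u. indicator (ball 0 1 - {0}) u * f (T (sgn u)) \<partial>lborel) =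
      (\<integral>\<^sup>+u. indicator (ball 0 1 - {0}) (T u) * f (sgn (T u)) \<partial>lborel)"
    by (simp add: orthogonal_transformation_sgn[OF T] orthogonal_transformation_norm[OF T]
        orthogonal_transformation_eq_0_iff[OF T] indicator_def)
  also have "\<dots> = (\<integral>\<^sup>+u. indicator (ball 0 1 - {0}) u * f (sgn u) \<partial>lborel)"
    by (rule nn_integral_lborel_orthogonal_transformation[OF T]) measurable
  finally show ?thesis
    by (simp add: nn_integral_unit_sphere_measure subspace_lborel_UNIV)
qed

text \<open>The bases selected in \<open>tangent_space x\<close> and
  \<open>tangent_space (T x)\<close> are unrelated, so the two sides are compared as ambient
  integrals: \<open>T\<close> preserves \<open>v \<bullet> x\<close> and commutes with the
  projection and with \<open>sgn\<close>.\<close>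

lemma nn_integral_tangent_sphere_orthogonal_transformation:
  fixes g :: "'a::euclidean_space \<Rightarrow> ennreal" and T :: "'a \<Rightarrow> 'a"
  assumes T: "orthogonal_transformation T" and x: "x \<in> sphere 0 1" and [measurable]: "g \<in> borel_measurable borel"
  shows "(\<integral>\<^sup>+w. g (T w) \<partial>unit_sphere_measure (tangent_space x)) = (\<integral>\<^sup>+w. g w \<partial>unit_sphere_measure (tangent_space (T x)))"
proof -
  note [measurable] = borel_measurable_orthogonal_transformation[OF T]
  have [measurable]: "ball 0 1 - {0} \<in> sets (borel :: 'a measure)" by auto
  have Tx: "T x \<in> sphere 0 1" using x by (simp add: orthogonal_transformation_norm[OF T])
  define F where "F v = indicator {0..1} (v \<bullet> T x) *
      (indicator (ball 0 1 - {0}) (v - (v \<bullet> T x) *\<^sub>R T x) * g (sgn (v - (v \<bullet> T x) *\<^sub>R T x)))" for v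
  have [measurable]: "F \<in> borel_measurable borel" unfolding F_def by measurable
  have T_proj: "T v - (T v \<bullet> T x) *\<^sub>R T x = T (v - (v \<bullet> x) *\<^sub>R x)" for v
    using T by (simp add: orthogonal_transformation_def linear_diff linear_scale)
  have "F (T v) = indicator {0..1} (v \<bullet> x) *
      (indicator (ball 0 1 - {0}) (v - (v \<bullet> x) *\<^sub>R x) * g (T (sgn (v - (v \<bullet> x) *\<^sub>R x))))" for v
  proof -
    have "T v \<bullet> T x = v \<bullet> x" using T by (simp add: orthogonal_transformation_def)
    then show ?thesis
      unfolding F_def T_proj
      by (simp add: orthogonal_transformation_sgn[OF T] orthogonal_transformation_norm[OF T]
        orthogonal_transformation_eq_0_iff[OF T] indicator_def del: eq_iff_diff_eq_0)
  qed
  then have "(\<integral>\<^sup>+w. g (T w) \<partial>unit_sphere_measure (tangent_space x)) = of_nat (DIM('a) - 1) * (\<integral>\<^sup>+v. F (T v) \<partial>lborel)"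
    by (subst nn_integral_tangent_sphere[OF x]) simp_all
  also have "(\<integral>\<^sup>+v. F (T v) \<partial>lborel) = (\<integral>\<^sup>+v. F v \<partial>lborel)"
    by (rule nn_integral_lborel_orthogonal_transformation[OF T]) measurable
  also have "of_nat (DIM('a) - 1) * \<dots> = (\<integral>\<^sup>+w. g w \<partial>unit_sphere_measure (tangent_space (T x)))"
    unfolding F_def by (subst nn_integral_tangent_sphere[OF Tx]) simp_all
  finally show ?thesis .
qed

text \<open>For a unit vector \<open>v\<close> this is the reflection in the hyperplane orthogonal
  to \<open>v\<close>. Reflections form a family of orthogonal maps indexed by the sphere itself, so
  one can average over them with the surface measure and needs no Haar measure on the orthogonal
  group.\<close>

definition reflect :: "'a::real_inner \<Rightarrow> 'a \<Rightarrow> 'a" where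
  "reflect v x = x - (2 * (v \<bullet> x)) *\<^sub>R v"

lemma linear_reflect: "linear (reflect v)"
  unfolding reflect_def by (intro linearI) (simp_all add: algebra_simps inner_add_right)

lemma orthogonal_transformation_reflect:
  assumes v: "norm v = 1"
  shows "orthogonal_transformation (reflect v)"
proof -
  have "reflect v x \<bullet> reflect v y = x \<bullet> y" for x y
    using v by (simp add: reflect_def inner_diff_left inner_diff_right inner_commute norm_eq_1 algebra_simps)
  then show ?thesis using linear_reflect by (auto simp: orthogonal_transformation_def)
qed

lemma borel_measurable_reflect [measurable (raw)]:
  fixes f g :: "'b \<Rightarrow> 'a::euclidean_space"
  assumes [measurable]: "f \<in> borel_measurable M" "g \<in> borel_measurable M"
  shows "(\<lambda>z. reflect (f z) (g z)) \<in> borel_measurable M"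
  unfolding reflect_def by measurable

text \<open>The orthogonal map \<open>- reflect x\<close> fixes \<open>x\<close> and acts as -1 on
  its tangent space.\<close>

lemma nn_integral_tangent_sphere_uminus:
  fixes g :: "'a::euclidean_space \<Rightarrow> ennreal"
  assumes x: "x \<in> sphere 0 1" and [measurable]: "g \<in> borel_measurable borel"
  shows "(\<integral>\<^sup>+w. g (- w) \<partial>unit_sphere_measure (tangent_space x)) = (\<integral>\<^sup>+w. g w \<partial>unit_sphere_measure (tangent_space x))"
proof -
  let ?T = "\<lambda>z. - reflect x z"
  have T: "orthogonal_transformation ?T"
    using orthogonal_transformation_reflect[of x] x by (auto simp: orthogonal_transformation_def intro: linear_compose_neg)
  have "?T w = - w" if "w \<in> tangent_space x" for w
    using that by (simp add: reflect_def tangent_space_def orthogonal_def)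
  then have "(\<integral>\<^sup>+w. g (- w) \<partial>unit_sphere_measure (tangent_space x)) = (\<integral>\<^sup>+w. g (?T w) \<partial>unit_sphere_measure (tangent_space x))"
    by (intro nn_integral_cong) simp
  also have "\<dots> = (\<integral>\<^sup>+w. g w \<partial>unit_sphere_measure (tangent_space (?T x)))"
    by (rule nn_integral_tangent_sphere_orthogonal_transformation[OF T x]) measurable
  also have "?T x = x"
    using x by (simp add: reflect_def dot_square_norm) (metis add_diff_cancel_left' scaleR_2)
  finally show ?thesis .
qed

subsection \<open>Geodesic averages of null sets\<close>

text \<open>If \<open>v\<close> has polar coordinates \<open>s\<close>, \<open>w\<close> about
  \<open>p\<close>, then \<open>reflect v p\<close> is the point \<open>cos q p + sin q w\<close>
  with \<open>q = 2 s - pi\<close>. An affine change of \<open>s\<close> preserves null sets of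
  radii, so nullity of \<open>f\<close> pulls back along
  \<open>v \<mapsto> reflect v p\<close>.\<close>

lemma nn_integral_reflect_null:
  fixes f :: "'a::euclidean_space \<Rightarrow> ennreal"
  assumes p: "p \<in> sphere 0 1" and N: "DIM('a) \<ge> 2" and [measurable]: "f \<in> borel_measurable borel"
    and null: "(\<integral>\<^sup>+z. f z \<partial>unit_sphere_measure UNIV) = 0"
  shows "(\<integral>\<^sup>+v. f (reflect v p) \<partial>unit_sphere_measure UNIV) = 0"
proof -
  have pp: "p \<bullet> p = 1" using p by (simp add: dot_square_norm)
  define h where "h q = (\<integral>\<^sup>+w. f (cos q *\<^sub>R p + sin q *\<^sub>R w) \<partial>unit_sphere_measure (tangent_space p))" for q
  have [measurable]: "h \<in> borel_measurable borel"
    unfolding h_def using p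
    by (intro borel_measurable_nn_integral_tangent_sphere[where h="\<lambda>(q, w). f (cos q *\<^sub>R p + sin q *\<^sub>R w)" and X="\<lambda>_. p", simplified]) auto
  \<comment> \<open>For \<open>s < pi / 2\<close> the radius \<open>2 s - pi\<close> is negative;
    replacing \<open>w\<close> by \<open>- w\<close> folds it back to
    \<open>pi - 2 s\<close>.\<close>
  have h_uminus: "h (- q) = h q" for q
    unfolding h_def
    using nn_integral_tangent_sphere_uminus[OF p, of "\<lambda>w. f (cos q *\<^sub>R p + sin q *\<^sub>R w)"] by simp
  have "(\<integral>\<^sup>+r. indicator {0<..<pi} r * (ennreal (sin r ^ (DIM('a) - 2)) * h r) \<partial>lborel) = 0"
    using nn_integral_sphere_polar[OF p N, of f] null by (simp add: h_def)
  then have "AE r in lborel. indicator {0<..<pi} r * (ennreal (sin r ^ (DIM('a) - 2)) * h r) = 0"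
    by (subst (asm) nn_integral_0_iff_AE) auto
  then have AE: "AE r in lborel. r \<in> {0<..<pi} \<longrightarrow> h r = 0"
  proof eventually_elim
    case (elim r)
    have "sin r ^ (DIM('a) - 2) > 0" if "r \<in> {0<..<pi}"
      using that by (intro zero_less_power sin_gt_zero) auto
    then show ?case using elim by (auto simp: indicator_def ennreal_eq_0_iff not_le)
  qed
  \<comment> \<open>\<open>pi - 2 s\<close> lies in \<open>(0, pi)\<close> for
    \<open>s < pi / 2\<close>, and \<open>2 s - pi\<close> does for \<open>s > pi / 2\<close>. At
    \<open>s = pi / 2\<close> the radius is 0, where nothing is known about \<open>h\<close>; this
    single point is discarded.\<close>
  have AE1: "AE s in lborel. pi + (-2) * s \<in> {0<..<pi} \<longrightarrow> h (pi + (-2) * s) = 0"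
    by (rule AE_borel_affine[OF _ _ AE]) auto
  have AE2: "AE s in lborel. - pi + 2 * s \<in> {0<..<pi} \<longrightarrow> h (- pi + 2 * s) = 0"
    by (rule AE_borel_affine[OF _ _ AE]) auto
  have AE3: "AE s in lborel. s \<noteq> pi / 2"
    by (rule AE_lborel_singleton)
  have "(\<integral>\<^sup>+v. f (reflect v p) \<partial>unit_sphere_measure UNIV) =
      (\<integral>\<^sup>+s. indicator {0<..<pi} s * (ennreal (sin s ^ (DIM('a) - 2)) *
        (\<integral>\<^sup>+w. f (reflect (cos s *\<^sub>R p + sin s *\<^sub>R w) p) \<partial>unit_sphere_measure (tangent_space p))) \<partial>lborel)"
    by (rule nn_integral_sphere_polar[OF p N]) measurable
  also have "\<dots> = (\<integral>\<^sup>+s. 0 \<partial>(lborel :: real measure))"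
  proof (rule nn_integral_cong_AE)
    show "AE s in lborel. indicator {0<..<pi} s * (ennreal (sin s ^ (DIM('a) - 2)) *
        (\<integral>\<^sup>+w. f (reflect (cos s *\<^sub>R p + sin s *\<^sub>R w) p) \<partial>unit_sphere_measure (tangent_space p))) = 0"
      using AE1 AE2 AE3
    proof eventually_elim
      case (elim s)
      have "reflect (cos s *\<^sub>R p + sin s *\<^sub>R w) p = cos (- pi + 2 * s) *\<^sub>R p + sin (- pi + 2 * s) *\<^sub>R w"
        if "w \<in> tangent_space p" for w
      proof -
        have "w \<bullet> p = 0" using that by (simp add: tangent_space_def orthogonal_def inner_commute)
        then have "reflect (cos s *\<^sub>R p + sin s *\<^sub>R w) p = (1 - 2 * cos s * cos s) *\<^sub>R p + (- 2 * sin s * cos s) *\<^sub>R w"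
          by (simp add: reflect_def inner_add_left pp scaleR_add_right scaleR_diff_left algebra_simps)
        also have "1 - 2 * cos s * cos s = cos (- pi + 2 * s)"
          using cos_double_cos[of s] by (simp add: cos_add power2_eq_square)
        also have "- 2 * sin s * cos s = sin (- pi + 2 * s)"
          by (simp add: sin_add sin_double)
        finally show ?thesis .
      qed
      then have "(\<integral>\<^sup>+w. f (reflect (cos s *\<^sub>R p + sin s *\<^sub>R w) p) \<partial>unit_sphere_measure (tangent_space p)) = h (- pi + 2 * s)"
        unfolding h_def by (intro nn_integral_cong) simp
      moreover have "h (- pi + 2 * s) = 0" if s: "s \<in> {0<..<pi}"
      proof (cases "s < pi / 2")
        case True
        then have "h (pi + (-2) * s) = 0" using elim(1) s by auto
        then show ?thesis using h_uminus[of "pi + (-2) * s"] by (simp add: algebra_simps)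
      next
        case False
        then show ?thesis using elim(2,3) s by auto
      qed
      ultimately show ?case by (auto simp: indicator_def)
    qed
  qed
  finally show ?thesis by simp
qed

text \<open>Invariance under the reflections \<open>R\<^sub>v\<close> lets us average over \<open>v\<close>; the averaged integrand is
  \<open>f (R\<^sub>v p)\<close>, to which the previous lemma applies. This gives the claim for every \<open>r\<close>, where polar
  coordinates alone give it only for almost every \<open>r\<close>.\<close>

lemma nn_integral_geodesic_average_null:
  fixes f :: "'a::euclidean_space \<Rightarrow> ennreal"
  assumes N: "DIM('a) \<ge> 2" and [measurable]: "f \<in> borel_measurable borel"
    and null: "(\<integral>\<^sup>+z. f z \<partial>unit_sphere_measure UNIV) = 0"
  shows "(\<integral>\<^sup>+x. \<integral>\<^sup>+w. f (cos r *\<^sub>R x + sin r *\<^sub>R w) \<partial>unit_sphere_measure (tangent_space x) \<partial>unit_sphere_measure UNIV) = 0"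
    (is "?A = 0")
proof -
  let ?S = "unit_sphere_measure UNIV :: 'a measure"
  let ?Sx = "\<lambda>x. unit_sphere_measure (tangent_space x) :: 'a measure"
  interpret S: finite_measure ?S
    using N by (intro finite_measure_unit_sphere_measure) auto
  interpret SS: pair_sigma_finite ?S ?S ..
  have fin: "finite_measure (?Sx x)" if "x \<in> sphere 0 1" for x
    using N dim_tangent_space[OF that] by (intro finite_measure_unit_sphere_measure subspace_tangent_space) auto
  define e where "e x w = cos r *\<^sub>R x + sin r *\<^sub>R w" for x w :: 'a
  have idS [measurable]: "(\<lambda>x. x) \<in> ?S \<rightarrow>\<^sub>M borel" by (rule borel_measurable_unit_sphere_measure) simp
  have e_meas [measurable]: "(\<lambda>z. e (g z) (k z)) \<in> borel_measurable M"
    if [measurable]: "g \<in> borel_measurable M" "k \<in> borel_measurable M" for M :: "'b measure" and g k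
    unfolding e_def by measurable
  have e_sphere: "e x w \<in> sphere 0 1" if "x \<in> sphere 0 1" "w \<in> sphere 0 1 \<inter> tangent_space x" for x w
    using norm_cos_sin[of x w r] that by (simp add: e_def tangent_space_def orthogonal_def)
  have inv: "(\<integral>\<^sup>+x. \<integral>\<^sup>+w. f (reflect v (e x w)) \<partial>?Sx x \<partial>?S) = ?A" if v: "v \<in> sphere 0 1" for v
  proof -
    have T: "orthogonal_transformation (reflect v)"
      using v by (intro orthogonal_transformation_reflect) simp
    have [measurable]: "reflect v \<in> borel_measurable borel"
      by (rule borel_measurable_orthogonal_transformation[OF T])
    have [measurable]: "ball 0 1 - {0} \<in> sets (borel :: 'a measure)" by auto
    \<comment> \<open>The inner integral, written so that it is a Borel function of \<open>x\<close>
      on the whole ambient space, as invariance of the surface measure under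
      \<open>reflect v\<close> requires.\<close>
    define J where "J x = of_nat (DIM('a) - 1) * (\<integral>\<^sup>+v. indicator {0..1} (v \<bullet> x) *
      (indicator (ball 0 1 - {0}) (v - (v \<bullet> x) *\<^sub>R x) * f (e x (sgn (v - (v \<bullet> x) *\<^sub>R x)))) \<partial>lborel)" for x
    have [measurable]: "J \<in> borel_measurable borel" unfolding J_def by measurable
    have J: "(\<integral>\<^sup>+w. f (e x w) \<partial>?Sx x) = J x" if "x \<in> sphere 0 1" for x
      unfolding J_def by (rule nn_integral_tangent_sphere[OF that]) measurable
    have "(\<integral>\<^sup>+w. f (reflect v (e x w)) \<partial>?Sx x) = J (reflect v x)" if x: "x \<in> sphere 0 1" for x
    proof -
      have "(\<integral>\<^sup>+w. f (reflect v (e x w)) \<partial>?Sx x) = (\<integral>\<^sup>+w. f (e (reflect v x) (reflect v w)) \<partial>?Sx x)"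
        by (simp add: e_def linear_add[OF linear_reflect] linear_scale[OF linear_reflect])
      also have "\<dots> = (\<integral>\<^sup>+w. f (e (reflect v x) w) \<partial>?Sx (reflect v x))"
        by (rule nn_integral_tangent_sphere_orthogonal_transformation[OF T x]) measurable
      also have "\<dots> = J (reflect v x)"
        using x by (intro J) (simp add: orthogonal_transformation_norm[OF T])
      finally show ?thesis .
    qed
    then have "(\<integral>\<^sup>+x. \<integral>\<^sup>+w. f (reflect v (e x w)) \<partial>?Sx x \<partial>?S) = (\<integral>\<^sup>+x. J (reflect v x) \<partial>?S)"
      by (intro nn_integral_cong) simp
    also have "\<dots> = (\<integral>\<^sup>+x. J x \<partial>?S)"
      by (rule nn_integral_sphere_orthogonal_transformation[OF T]) measurable
    also have "\<dots> = ?A"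
      by (intro nn_integral_cong) (simp add: J[symmetric] e_def)
    finally show ?thesis .
  qed
  have "?A * emeasure ?S (space ?S) = (\<integral>\<^sup>+v. \<integral>\<^sup>+x. \<integral>\<^sup>+w. f (reflect v (e x w)) \<partial>?Sx x \<partial>?S \<partial>?S)"
    using inv by (simp cong: nn_integral_cong_simp)
  also have "\<dots> = (\<integral>\<^sup>+x. \<integral>\<^sup>+v. \<integral>\<^sup>+w. f (reflect v (e x w)) \<partial>?Sx x \<partial>?S \<partial>?S)"
  proof (rule SS.Fubini'[where f="\<lambda>x v. \<integral>\<^sup>+w. f (reflect v (e x w)) \<partial>?Sx x"])
    show "(\<lambda>(x, v). \<integral>\<^sup>+w. f (reflect v (e x w)) \<partial>?Sx x) \<in> borel_measurable (?S \<Otimes>\<^sub>M ?S)"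
      using borel_measurable_nn_integral_tangent_sphere[where M="?S \<Otimes>\<^sub>M ?S" and X=fst and
          h="\<lambda>((x, v), w). f (reflect v (e x w))"]
      by (auto simp: case_prod_beta' space_pair_measure)
  qed
  also have "\<dots> = (\<integral>\<^sup>+x. 0 \<partial>?S)"
  proof (rule nn_integral_cong)
    fix x assume "x \<in> space ?S"
    then have x: "x \<in> sphere 0 1" by simp
    interpret Sx: finite_measure "?Sx x" by (rule fin[OF x])
    interpret SSx: pair_sigma_finite "?Sx x" ?S ..
    have [measurable]: "(\<lambda>x. x) \<in> ?Sx x \<rightarrow>\<^sub>M borel" by (rule borel_measurable_unit_sphere_measure) simp
    have "(\<integral>\<^sup>+v. \<integral>\<^sup>+w. f (reflect v (e x w)) \<partial>?Sx x \<partial>?S) = (\<integral>\<^sup>+w. \<integral>\<^sup>+v. f (reflect v (e x w)) \<partial>?S \<partial>?Sx x)"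
      by (rule SSx.Fubini') measurable
    also have "\<dots> = (\<integral>\<^sup>+w. 0 \<partial>?Sx x)"
      using e_sphere[OF x] by (intro nn_integral_cong nn_integral_reflect_null[OF _ N _ null]) auto
    finally show "(\<integral>\<^sup>+v. \<integral>\<^sup>+w. f (reflect v (e x w)) \<partial>?Sx x \<partial>?S) = 0" by simp
  qed
  finally have "?A * emeasure ?S (space ?S) = 0" by simp
  \<comment> \<open>The sphere has positive area, so the factor produced by averaging over
    \<open>v\<close> can be cancelled.\<close>
  have "dim (UNIV :: 'a set) = (DIM('a) - 1) + 1" using N by simp
  note emeasure_space_unit_sphere_measure[OF subspace_UNIV this]
  then have "emeasure ?S (space ?S) \<noteq> 0"
    using sphere_area_pos[of "DIM('a) - 1"] by simp
  with \<open>?A * emeasure ?S (space ?S) = 0\<close> show ?thesis by simp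
qed

subsection \<open>Geodesic distance\<close>

lemma abs_inner_less_1:
  fixes x y :: "'a::euclidean_space"
  assumes "x \<in> sphere 0 1" "y \<in> sphere 0 1" "x \<noteq> y" "x \<noteq> - y"
  shows "-1 < x \<bullet> y" "x \<bullet> y < 1"
proof -
  have xx: "x \<bullet> x = 1" "y \<bullet> y = 1" using assms(1,2) by (simp_all add: dot_square_norm)
  have "(x - y) \<bullet> (x - y) > 0" "(x + y) \<bullet> (x + y) > 0"
    using assms(3,4) by (auto simp: inner_gt_zero_iff eq_neg_iff_add_eq_0)
  then show "-1 < x \<bullet> y" "x \<bullet> y < 1"
    by (auto simp: inner_add_left inner_add_right inner_diff_left inner_diff_right inner_commute[of y x] xx)
qed

text \<open>The height \<open>s = g \<bullet> x\<close> satisfies \<open>|s'| \<le> |g'| sqrt (1 - s\<^sup>2)\<close>, so \<open>arccos s\<close> grows at most as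
  fast as the length of \<open>g\<close>. The factor \<open>c < 1\<close> keeps \<open>arccos (c s)\<close> differentiable at the poles;
  afterwards \<open>c\<close> tends to 1.\<close>

lemma arccos_le_curve_length:
  fixes x y :: "'a::euclidean_space"
  assumes C1: "g C1_differentiable_on {0..1}" and sph: "path_image g \<subseteq> sphere 0 1"
    and g0: "pathstart g = x" and g1: "pathfinish g = y"
  shows "arccos (x \<bullet> y) \<le> curve_length g"
proof -
  obtain D where D: "\<And>t. t \<in> {0..1} \<Longrightarrow> (g has_vector_derivative D t) (at t)"
    and contD: "continuous_on {0..1} D"
    using C1 unfolding C1_differentiable_on_def by blast
  have ng: "norm (g t) = 1" if "t \<in> {0..1}" for t
  proof -
    have "g t \<in> sphere 0 1" using sph imageI[OF that, of g] unfolding path_image_def by blast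
    then show ?thesis by simp
  qed
  have x: "norm x = 1" and y: "norm y = 1"
    using ng[of 0] ng[of 1] g0 g1 by (auto simp: pathstart_def pathfinish_def)
  \<comment> \<open>Differentiate \<open>g \<bullet> g = 1\<close>. This identity is known only on
    \<open>{0..1}\<close>, hence derivatives within the interval and their uniqueness up to the end
    points.\<close>
  have D_orth: "g t \<bullet> D t = 0" if t: "t \<in> {0..1}" for t
  proof -
    have Dt: "(g has_vector_derivative D t) (at t within {0..1})"
      using D[OF t] by (rule has_vector_derivative_at_within)
    have "((\<lambda>s. g s \<bullet> g s) has_vector_derivative g t \<bullet> D t + D t \<bullet> g t) (at t within cbox 0 1)"
      using bounded_bilinear.has_vector_derivative[OF bounded_bilinear_inner Dt Dt] by simp
    moreover have "((\<lambda>s. g s \<bullet> g s) has_vector_derivative 0) (at t within cbox 0 1)"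
      using has_vector_derivative_const[of "1::real" "at t within cbox 0 1"]
      by (rule has_vector_derivative_transform[rotated 2]) (use t ng in \<open>auto simp: dot_square_norm\<close>)
    ultimately have "g t \<bullet> D t + D t \<bullet> g t = 0"
      using t by (intro vector_derivative_unique_within_closed_interval[of 0 1 t "\<lambda>s. g s \<bullet> g s"]) auto
    then show ?thesis by (simp add: inner_commute)
  qed
  have len: "curve_length g = integral {0..1} (\<lambda>t. norm (D t))"
    unfolding curve_length_def
    by (intro Henstock_Kurzweil_Integration.integral_cong) (simp add: vector_derivative_at[OF D])
  have approx: "arccos (c * (y \<bullet> x)) - arccos c \<le> curve_length g" if c: "0 < c" "c < 1" for c
  proof -
    define s where "s t = g t \<bullet> x" for t
    have s_le: "\<bar>s t\<bar> \<le> 1" if "t \<in> {0..1}" for t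
      using Cauchy_Schwarz_ineq2[of "g t" x] ng[OF that] x by (simp add: s_def)
    have cs: "\<bar>c * s t\<bar> < 1" if "t \<in> {0..1}" for t
    proof -
      have "\<bar>c * s t\<bar> \<le> c * 1" unfolding abs_mult using c s_le[OF that] by (intro mult_mono) auto
      then show ?thesis using c by simp
    qed
    define \<phi>' where "\<phi>' t = inverse (- sqrt (1 - (c * s t)\<^sup>2)) * (c * (D t \<bullet> x))" for t
    have deriv: "((\<lambda>t. arccos (c * s t)) has_vector_derivative \<phi>' t) (at t within {0..1})" if t: "t \<in> {0..1}" for t
    proof -
      have "(s has_vector_derivative D t \<bullet> x) (at t)"
        unfolding s_def using bounded_linear.has_vector_derivative[OF bounded_linear_inner_left D[OF t]] .
      then have "((\<lambda>t. c * s t) has_real_derivative c * (D t \<bullet> x)) (at t within {0..1})"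
        by (intro DERIV_cmult) (simp add: has_real_derivative_iff_has_vector_derivative has_vector_derivative_at_within)
      moreover have "DERIV arccos (c * s t) :> inverse (- sqrt (1 - (c * s t)\<^sup>2))"
        using cs[OF t] by (intro DERIV_arccos) auto
      ultimately show ?thesis
        unfolding \<phi>'_def has_real_derivative_iff_has_vector_derivative[symmetric]
        by (rule DERIV_chain2[rotated])
    qed
    have bound: "norm (\<phi>' t) \<le> norm (D t)" if t: "t \<in> {0..1}" for t
    proof -
      have pos: "1 - (c * s t)\<^sup>2 > 0"
        using cs[OF t] abs_square_less_1[of "c * s t"] by simp
      \<comment> \<open>\<open>x - s t *\<^sub>R g t\<close> is the part of \<open>x\<close>
        orthogonal to \<open>g t\<close>. The velocity, being orthogonal to \<open>g t\<close>, sees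
        only this part, which improves Cauchy-Schwarz by the factor
        \<open>sqrt (1 - (s t)\<^sup>2)\<close>.\<close>
      have "(x - s t *\<^sub>R g t) \<bullet> (x - s t *\<^sub>R g t) = 1 - (s t)\<^sup>2"
        using x ng[OF t] by (simp add: inner_diff_left inner_diff_right norm_eq_1 s_def inner_commute power2_eq_square)
      then have n: "norm (x - s t *\<^sub>R g t) = sqrt (1 - (s t)\<^sup>2)" by (simp add: norm_eq_sqrt_inner)
      have "D t \<bullet> x = D t \<bullet> (x - s t *\<^sub>R g t)"
        using D_orth[OF t] by (simp add: inner_diff_right inner_commute)
      then have "\<bar>D t \<bullet> x\<bar> \<le> norm (D t) * sqrt (1 - (s t)\<^sup>2)"
        using Cauchy_Schwarz_ineq2[of "D t" "x - s t *\<^sub>R g t"] n by simp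
      then have "c * \<bar>D t \<bullet> x\<bar> \<le> norm (D t) * (c * sqrt (1 - (s t)\<^sup>2))"
        using c by (simp add: mult.left_commute mult_left_mono)
      also have "c * sqrt (1 - (s t)\<^sup>2) = sqrt (c\<^sup>2 * (1 - (s t)\<^sup>2))"
        using c by (simp add: real_sqrt_mult)
      also have "\<dots> \<le> sqrt (1 - (c * s t)\<^sup>2)"
      proof (rule real_sqrt_le_mono)
        have "c\<^sup>2 \<le> 1" using c by (simp add: abs_square_le_1)
        then show "c\<^sup>2 * (1 - (s t)\<^sup>2) \<le> 1 - (c * s t)\<^sup>2"
          by (simp add: power_mult_distrib right_diff_distrib)
      qed
      finally have "c * \<bar>D t \<bullet> x\<bar> \<le> norm (D t) * sqrt (1 - (c * s t)\<^sup>2)"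
        by (simp add: mult_left_mono)
      then show ?thesis
        using pos c by (simp add: \<phi>'_def abs_mult field_simps)
    qed
    have "(\<phi>' has_integral arccos (c * s 1) - arccos (c * s 0)) {0..1}"
      by (rule fundamental_theorem_of_calculus) (use deriv in auto)
    moreover from this have "norm (integral {0..1} \<phi>') \<le> integral {0..1} (\<lambda>t. norm (D t))"
      by (intro integral_norm_bound_integral bound integrable_continuous_real continuous_on_norm contD has_integral_integrable)
    ultimately have "norm (arccos (c * s 1) - arccos (c * s 0)) \<le> integral {0..1} (\<lambda>t. norm (D t))"
      by (simp add: integral_unique)
    moreover have "s 1 = y \<bullet> x" "s 0 = 1"
      using g0 g1 x by (auto simp: s_def pathstart_def pathfinish_def dot_square_norm)
    ultimately show ?thesis unfolding len by simp
  qed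
  \<comment> \<open>The shift to \<open>j + 2\<close> keeps \<open>c j\<close> positive already at
    \<open>j = 0\<close>.\<close>
  define c where "c j = 1 - 1 / real (Suc (Suc j))" for j
  have c: "0 < c j" "c j < 1" for j by (simp_all add: c_def)
  have "c \<longlonglongrightarrow> 1 - 0"
    unfolding c_def[abs_def] by (intro tendsto_intros LIMSEQ_Suc lim_1_over_n)
  then have c_lim: "c \<longlonglongrightarrow> 1" by simp
  have yx: "\<bar>y \<bullet> x\<bar> \<le> 1" using Cauchy_Schwarz_ineq2[of y x] x y by simp
  have cyx: "\<bar>c j * (y \<bullet> x)\<bar> \<le> 1" for j
    unfolding abs_mult using c[of j] yx by (simp add: mult_le_one)
  have "(\<lambda>j. arccos (c j * (y \<bullet> x))) \<longlonglongrightarrow> arccos (1 * (y \<bullet> x))"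
    by (rule continuous_on_tendsto_compose[OF continuous_on_arccos'])
       (use yx cyx tendsto_mult_right[OF c_lim, of "y \<bullet> x"] in \<open>auto simp: abs_le_iff minus_le_iff\<close>)
  moreover have "(\<lambda>j. arccos (c j)) \<longlonglongrightarrow> arccos 1"
  proof (rule continuous_on_tendsto_compose[OF continuous_on_arccos' c_lim])
    have "c j \<in> {-1..1}" for j using c[of j] by auto
    then show "\<forall>\<^sub>F j in sequentially. c j \<in> {-1..1}" by (intro always_eventually allI)
  qed simp
  ultimately have "(\<lambda>j. arccos (c j * (y \<bullet> x)) - arccos (c j)) \<longlonglongrightarrow> arccos (1 * (y \<bullet> x)) - arccos 1"
    by (rule tendsto_diff)
  then have "arccos (1 * (y \<bullet> x)) - arccos 1 \<le> curve_length g"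
    by (rule LIMSEQ_le_const2) (use approx c in blast)
  then show ?thesis by (simp add: inner_commute)
qed

text \<open>The lower bound is attained by the great-circle arc run at constant speed
  \<open>\<theta>\<close>, so the infimum is a minimum. Excluding \<open>x = y\<close> and
  \<open>x = - y\<close> makes \<open>sin \<theta>\<close> nonzero, which the direction
  \<open>e\<close> of the arc needs.\<close>

lemma geodesic_dist_eq_arccos:
  fixes x y :: "'a::euclidean_space"
  assumes x: "x \<in> sphere 0 1" and y: "y \<in> sphere 0 1" and ne: "x \<noteq> y" "x \<noteq> - y"
  shows "geodesic_dist x y = arccos (x \<bullet> y)"
proof -
  define \<theta> where "\<theta> = arccos (x \<bullet> y)"
  note xy = abs_inner_less_1[OF x y ne]
  have \<theta>: "0 < \<theta>" "\<theta> < pi" using arccos_lt_bounded[OF xy] by (auto simp: \<theta>_def)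
  have cos\<theta>: "cos \<theta> = x \<bullet> y" using xy by (simp add: \<theta>_def)
  have sin\<theta>: "sin \<theta> > 0" using \<theta> by (intro sin_gt_zero)
  have xx: "x \<bullet> x = 1" "y \<bullet> y = 1" using x y by (simp_all add: dot_square_norm)
  \<comment> \<open>The unit tangent vector at \<open>x\<close> pointing towards \<open>y\<close>,
    that is, the normalised component of \<open>y\<close> orthogonal to \<open>x\<close>.\<close>
  define e where "e = (1 / sin \<theta>) *\<^sub>R (y - cos \<theta> *\<^sub>R x)"
  have xe: "x \<bullet> e = 0" by (simp add: e_def inner_diff_right cos\<theta> xx)
  have ne: "norm e = 1"
  proof -
    have "(y - cos \<theta> *\<^sub>R x) \<bullet> (y - cos \<theta> *\<^sub>R x) = 1 - (cos \<theta>)\<^sup>2"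
      by (simp add: inner_diff_right inner_diff_left cos\<theta> xx inner_commute[of y x] power2_eq_square)
    also have "\<dots> = (sin \<theta>)\<^sup>2" by (simp add: sin_squared_eq)
    finally have "norm (y - cos \<theta> *\<^sub>R x) = sin \<theta>" using sin\<theta> by (simp add: norm_eq_sqrt_inner)
    then show ?thesis using sin\<theta> by (simp add: e_def)
  qed
  define g where "g t = cos (\<theta> * t) *\<^sub>R x + sin (\<theta> * t) *\<^sub>R e" for t
  define D where "D t = \<theta> *\<^sub>R (cos (\<theta> * t) *\<^sub>R e + sin (\<theta> * t) *\<^sub>R (- x))" for t
  have D: "(g has_vector_derivative D t) (at t)" for t
    unfolding g_def D_def
    by (auto intro!: derivative_eq_intros has_vector_derivative_real_field simp: algebra_simps
      simp flip: has_real_derivative_iff_has_vector_derivative)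
  have nD: "norm (D t) = \<theta>" for t
    using norm_cos_sin[of e "- x" "\<theta> * t"] ne x xe \<theta> by (simp add: D_def inner_commute)
  have "g C1_differentiable_on {0..1}"
    unfolding C1_differentiable_on_def using D
    by (intro exI[of _ D]) (auto simp: D_def intro!: continuous_intros)
  moreover have "path_image g \<subseteq> sphere 0 1"
    using norm_cos_sin[of x e] x ne xe by (auto simp: path_image_def g_def)
  moreover have "pathstart g = x" by (simp add: pathstart_def g_def)
  moreover have "pathfinish g = y" using sin\<theta> by (simp add: pathfinish_def g_def e_def)
  moreover have "curve_length g = \<theta>"
    by (simp add: curve_length_def vector_derivative_at[OF D] nD)
  ultimately have "\<theta> \<in> {curve_length g |g. g C1_differentiable_on {0..1} \<and>
     path_image g \<subseteq> sphere 0 1 \<and> pathstart g = x \<and> pathfinish g = y}" by blast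
  moreover have "\<theta> \<le> l" if "l \<in> {curve_length g |g. g C1_differentiable_on {0..1} \<and>
     path_image g \<subseteq> sphere 0 1 \<and> pathstart g = x \<and> pathfinish g = y}" for l
    using that arccos_le_curve_length unfolding \<theta>_def by blast
  ultimately show ?thesis
    unfolding geodesic_dist_def \<theta>_def[symmetric] by (rule cInf_eq_minimum)
qed

section \<open>Regularity of the radial profile\<close>

lemma smooth_on_sphere_imp_continuous_on:
  assumes "smooth_on_sphere U f"
  shows "continuous_on U f"
  unfolding continuous_on_eq_continuous_within
proof
  fix p assume p: "p \<in> U"
  obtain W g where W: "open W" "p \<in> W" and Ck: "\<forall>k. Ck_on k W g" and eq: "\<forall>x\<in>W \<inter> U. g x = f x"
    using bspec[OF assms[unfolded smooth_on_sphere_def] p] by (elim exE conjE)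
  have g: "Ck_on 0 W g" using Ck ..
  have "continuous (at p within U) g"
    using g W by (simp add: continuous_on_eq_continuous_at continuous_at_imp_continuous_at_within)
  then show "continuous (at p within U) f"
  proof (rule continuous_transform_within_openin)
    show "openin (top_of_set U) (U \<inter> W)" using W by (simp add: openin_open_Int)
  qed (use W p eq in auto)
qed

lemma inner_cos_sin:
  assumes "x \<in> sphere 0 1" "w \<in> tangent_space x"
  shows "x \<bullet> (cos r *\<^sub>R x + sin r *\<^sub>R w) = cos r"
  using assms by (simp add: inner_add_right tangent_space_def orthogonal_def dot_square_norm)

lemma radial_profile_eq:
  fixes x y :: "'a::euclidean_space"
  assumes k: "radial_profile K k" and x: "x \<in> sphere 0 1" and y: "y \<in> sphere 0 1" and ne: "x \<noteq> y" "x \<noteq> - y"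
  shows "K x y = k (arccos (x \<bullet> y))" "0 < arccos (x \<bullet> y)" "arccos (x \<bullet> y) < pi"
proof -
  note b = arccos_lt_bounded[OF abs_inner_less_1[OF x y ne]]
  show "0 < arccos (x \<bullet> y)" "arccos (x \<bullet> y) < pi" using b by auto
  have "0 < geodesic_dist x y \<and> geodesic_dist x y < pi \<longrightarrow> K x y = k (geodesic_dist x y)"
    using k x y unfolding radial_profile_def by blast
  then show "K x y = k (arccos (x \<bullet> y))"
    using b unfolding geodesic_dist_eq_arccos[OF x y ne] by blast
qed

text \<open>Along a unit-speed great circle leaving \<open>y\<close>, the kernel is
  \<open>k r\<close> at time \<open>r\<close>. This is the source of the Borel measurability of
  \<open>k\<close> on \<open>(0, pi)\<close>.\<close>

lemma continuous_on_radial_profile: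
  fixes K :: "'a::euclidean_space \<Rightarrow> 'a \<Rightarrow> real"
  assumes N: "DIM('a) \<ge> 2" and k: "radial_profile K k" and y: "y \<in> sphere 0 1"
    and cont: "continuous_on (sphere 0 1 - {y}) (\<lambda>x. K x y)"
  shows "continuous_on {0<..<pi} k"
proof -
  obtain w where w: "norm w = 1" "w \<in> tangent_space y" by (rule tangent_space_unit_vector[OF y N])
  define e where "e r = cos r *\<^sub>R y + sin r *\<^sub>R w" for r
  have yw: "y \<bullet> w = 0" using w by (simp add: tangent_space_def orthogonal_def)
  have sph: "e r \<in> sphere 0 1" for r using norm_cos_sin[of y w r] y w yw by (simp add: e_def)
  have inn: "e r \<bullet> y = cos r" for r using inner_cos_sin[OF y w(2), of r] by (simp add: e_def inner_commute)
  have yy: "y \<bullet> y = 1" using y by (simp add: dot_square_norm)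
  have ne: "e r \<noteq> y" "e r \<noteq> - y" if r: "r \<in> {0<..<pi}" for r
  proof -
    have "sin r > 0" using r by (intro sin_gt_zero) auto
    then have "(cos r)\<^sup>2 \<noteq> 1" by (simp add: cos_squared_eq)
    then show "e r \<noteq> y" "e r \<noteq> - y" using inn[of r] yy by (auto simp: power2_eq_1_iff)
  qed
  have "continuous_on {0<..<pi} (\<lambda>r. K (e r) y)"
    by (rule continuous_on_compose2[OF cont]) (use sph ne in \<open>auto simp: e_def intro!: continuous_intros\<close>)
  moreover have "K (e r) y = k r" if r: "r \<in> {0<..<pi}" for r
    using radial_profile_eq(1)[OF k sph y ne[OF r]] r by (simp add: inn arccos_cos)
  ultimately show ?thesis by (rule continuous_on_eq)
qed

subsection \<open>Integrals over pairs of points\<close>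

text \<open>Lets an integrand over a completed measure be replaced by a Borel representative with no
  prior measurability of the integrand.\<close>

lemma borel_measurable_completion_AE:
  assumes g: "g \<in> borel_measurable M" and ae: "AE x in M. f x = g x"
  shows "f \<in> borel_measurable (completion M)"
proof (rule measurableI)
  fix B :: "'b set" assume B: "B \<in> sets borel"
  have mem: "g -` B \<inter> space M \<in> sets (completion M)"
    using measurable_sets[OF g B] by (rule sets_completionI_sets)
  have "AE x in completion M. x \<in> g -` B \<inter> space M \<longleftrightarrow> x \<in> f -` B \<inter> space M"
    using AE_completion[OF ae] by eventually_elim auto
  then have "f -` B \<inter> space M \<in> sets (completion M)"
    by (rule completion.in_sets_AE[OF _ mem]) simp
  then show "f -` B \<inter> space (completion M) \<in> sets (completion M)"
    by simp
qed simp

lemma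
  fixes g :: "'a \<Rightarrow> 'b::{banach, second_countable_topology}"
  assumes g: "g \<in> borel_measurable M" and ae: "AE x in M. f x = g x"
  shows integral_completion_AE: "integral\<^sup>L (completion M) f = integral\<^sup>L M g"
    and integrable_completion_AE: "integrable (completion M) f \<longleftrightarrow> integrable M g"
  using integral_cong_AE[OF borel_measurable_completion_AE[OF g ae] measurable_completion[OF g] AE_completion[OF ae]]
    integrable_cong_AE[OF borel_measurable_completion_AE[OF g ae] measurable_completion[OF g] AE_completion[OF ae]]
  by (simp_all add: integral_completion[OF g] integrable_completion[OF g])

text \<open>Clipping makes the angle a Borel function on the whole ambient space; \<^const>\<open>arccos\<close> is
  unspecified outside \<open>[-1, 1]\<close>.\<close>

definition angle :: "'a::euclidean_space \<Rightarrow> 'a \<Rightarrow> real" where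
  "angle x y = arccos (max (- 1) (min 1 (x \<bullet> y)))"

lemma angle_commute: "angle x y = angle y x"
  by (simp add: angle_def inner_commute)

lemma angle_eq_arccos:
  assumes "x \<in> sphere 0 1" "y \<in> sphere 0 1"
  shows "angle x y = arccos (x \<bullet> y)"
proof -
  have "\<bar>x \<bullet> y\<bar> \<le> 1" using Cauchy_Schwarz_ineq2[of x y] assms by simp
  then have "max (- 1) (min 1 (x \<bullet> y)) = x \<bullet> y" by (simp add: abs_le_iff max_def min_def)
  then show ?thesis by (simp add: angle_def)
qed

lemma borel_measurable_angle [measurable (raw)]:
  fixes f g :: "'b \<Rightarrow> 'a::euclidean_space"
  assumes [measurable]: "f \<in> borel_measurable M" "g \<in> borel_measurable M"
  shows "(\<lambda>z. angle (f z) (g z)) \<in> borel_measurable M"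
proof -
  have "continuous_on UNIV (\<lambda>t::real. arccos (max (- 1) (min 1 t)))"
    by (rule continuous_on_compose2[OF continuous_on_arccos']) (auto intro!: continuous_intros)
  then have [measurable]: "(\<lambda>t::real. arccos (max (- 1) (min 1 t))) \<in> borel_measurable borel"
    by (rule borel_measurable_continuous_onI)
  show ?thesis unfolding angle_def by measurable
qed

lemma angle_cos_sin:
  assumes "x \<in> sphere 0 1" "w \<in> sphere 0 1 \<inter> tangent_space x" "0 < r" "r < pi"
  shows "angle x (cos r *\<^sub>R x + sin r *\<^sub>R w) = r"
proof -
  have "cos r *\<^sub>R x + sin r *\<^sub>R w \<in> sphere 0 1"
    using norm_cos_sin[of x w r] assms by (simp add: tangent_space_def orthogonal_def)
  then show ?thesis
    using assms inner_cos_sin[of x w r] by (simp add: angle_eq_arccos arccos_cos)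
qed

text \<open>For \<open>0 < r < pi\<close> this integrates \<open>q\<close> over the pairs at
  distance \<open>r\<close>. With \<open>q\<close> the indicator of \<open>A \<times> A\<close>,
  \<open>A\<close> Borel, it is the autocorrelation of \<open>A\<close> times
  \<open>sphere_area (DIM('a) - 2)\<close>. Values in \<open>ennreal\<close> and uncompleted
  measures let integrals be exchanged without integrability conditions.\<close>

definition pair_integral :: "('a::euclidean_space \<times> 'a \<Rightarrow> ennreal) \<Rightarrow> real \<Rightarrow> ennreal" where
  "pair_integral q r = (\<integral>\<^sup>+x. \<integral>\<^sup>+w. q (x, cos r *\<^sub>R x + sin r *\<^sub>R w)
     \<partial>unit_sphere_measure (tangent_space x) \<partial>unit_sphere_measure UNIV)"

lemma id_borel_measurable_unit_sphere_measure [measurable]: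
  "(\<lambda>x. x) \<in> unit_sphere_measure V \<rightarrow>\<^sub>M borel"
  by (rule borel_measurable_unit_sphere_measure) simp

lemma finite_measure_sphere:
  "finite_measure (unit_sphere_measure (UNIV :: 'a::euclidean_space set))"
  using DIM_positive[where 'a='a] by (intro finite_measure_unit_sphere_measure) auto

lemma borel_measurable_tangent_sphere_average:
  fixes q :: "'a::euclidean_space \<times> 'a \<Rightarrow> ennreal"
  assumes [measurable]: "q \<in> borel_measurable (borel \<Otimes>\<^sub>M borel)"
  shows "(\<lambda>(r, x). \<integral>\<^sup>+w. q (x, cos r *\<^sub>R x + sin r *\<^sub>R w) \<partial>unit_sphere_measure (tangent_space x))
    \<in> borel_measurable (borel \<Otimes>\<^sub>M unit_sphere_measure UNIV)"
proof -
  have "(\<lambda>p. \<integral>\<^sup>+w. (\<lambda>z. q (snd (fst z), cos (fst (fst z)) *\<^sub>R snd (fst z) + sin (fst (fst z)) *\<^sub>R snd z)) (p, w)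
      \<partial>unit_sphere_measure (tangent_space (snd p))) \<in> borel_measurable (borel \<Otimes>\<^sub>M unit_sphere_measure UNIV)"
    by (rule borel_measurable_nn_integral_tangent_sphere) (measurable, auto simp: space_pair_measure)
  then show ?thesis by (simp add: case_prod_beta')
qed

lemma borel_measurable_tangent_sphere_average':
  fixes q :: "'a::euclidean_space \<times> 'a \<Rightarrow> ennreal"
  assumes q: "q \<in> borel_measurable (borel \<Otimes>\<^sub>M borel)"
  shows "(\<lambda>x. \<integral>\<^sup>+w. q (x, cos r *\<^sub>R x + sin r *\<^sub>R w) \<partial>unit_sphere_measure (tangent_space x))
    \<in> borel_measurable (unit_sphere_measure UNIV)"
  using measurable_compose[OF measurable_Pair1'[of r borel "unit_sphere_measure UNIV"] borel_measurable_tangent_sphere_average[OF q]]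
  by simp

lemma borel_measurable_pair_integral:
  fixes q :: "'a::euclidean_space \<times> 'a \<Rightarrow> ennreal"
  assumes q: "q \<in> borel_measurable (borel \<Otimes>\<^sub>M borel)"
  shows "pair_integral q \<in> borel_measurable borel"
proof -
  interpret S: finite_measure "unit_sphere_measure (UNIV :: 'a set)" by (rule finite_measure_sphere)
  show ?thesis
    unfolding pair_integral_def using borel_measurable_tangent_sphere_average[OF q]
    by (rule S.borel_measurable_nn_integral)
qed

text \<open>On the geodesic sphere of radius \<open>r\<close> about \<open>x\<close> the angle is
  constantly \<open>r\<close>, so \<open>h r\<close> leaves the inner integral; what remains is to
  exchange the integrals over \<open>x\<close> and \<open>r\<close>.\<close>

lemma nn_integral_sphere_pairs:
  fixes q :: "'a::euclidean_space \<times> 'a \<Rightarrow> ennreal" and h :: "real \<Rightarrow> ennreal"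
  assumes N: "DIM('a) \<ge> 2" and [measurable]: "h \<in> borel_measurable borel" "q \<in> borel_measurable (borel \<Otimes>\<^sub>M borel)"
  shows "(\<integral>\<^sup>+z. h (angle (fst z) (snd z)) * q z \<partial>(unit_sphere_measure UNIV \<Otimes>\<^sub>M unit_sphere_measure UNIV)) =
    (\<integral>\<^sup>+r. indicator {0<..<pi} r * (ennreal (sin r ^ (DIM('a) - 2)) * (h r * pair_integral q r)) \<partial>lborel)"
proof -
  let ?S = "unit_sphere_measure UNIV :: 'a measure"
  let ?Sx = "\<lambda>x. unit_sphere_measure (tangent_space x) :: 'a measure"
  let ?I = "\<lambda>r x. \<integral>\<^sup>+w. q (x, cos r *\<^sub>R x + sin r *\<^sub>R w) \<partial>?Sx x"
  interpret S: finite_measure ?S by (rule finite_measure_sphere)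
  interpret LS: pair_sigma_finite "lborel :: real measure" ?S ..
  have q_meas [measurable]: "(\<lambda>z. q (f z, g z)) \<in> borel_measurable M"
    if [measurable]: "f \<in> borel_measurable M" "g \<in> borel_measurable M" for M :: "'b measure" and f g
    by measurable
  have I_meas: "case_prod ?I \<in> borel_measurable (lborel \<Otimes>\<^sub>M ?S)"
    using borel_measurable_tangent_sphere_average[OF assms(3)]
    by (simp cong: measurable_cong_sets add: sets_pair_measure_cong[OF sets_lborel refl])
  have I_meas': "?I r \<in> borel_measurable ?S" for r
    by (rule borel_measurable_tangent_sphere_average'[OF assms(3)])
  have hq: "(\<lambda>z. h (angle (fst z) (snd z)) * q z) \<in> borel_measurable (?S \<Otimes>\<^sub>M ?S)"
    using q_meas[of fst "?S \<Otimes>\<^sub>M ?S" snd] by simp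
  have "(\<integral>\<^sup>+z. h (angle (fst z) (snd z)) * q z \<partial>(?S \<Otimes>\<^sub>M ?S)) = (\<integral>\<^sup>+x. \<integral>\<^sup>+y. h (angle x y) * q (x, y) \<partial>?S \<partial>?S)"
    using S.nn_integral_fst[OF hq] by simp
  also have "\<dots> = (\<integral>\<^sup>+x. \<integral>\<^sup>+r. indicator {0<..<pi} r * (ennreal (sin r ^ (DIM('a) - 2)) * (h r * ?I r x)) \<partial>lborel \<partial>?S)"
  proof (rule nn_integral_cong)
    fix x assume "x \<in> space ?S"
    then have x: "x \<in> sphere 0 1" by simp
    have "(\<integral>\<^sup>+y. h (angle x y) * q (x, y) \<partial>?S) =
      (\<integral>\<^sup>+r. indicator {0<..<pi} r * (ennreal (sin r ^ (DIM('a) - 2)) *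
        (\<integral>\<^sup>+w. h (angle x (cos r *\<^sub>R x + sin r *\<^sub>R w)) * q (x, cos r *\<^sub>R x + sin r *\<^sub>R w) \<partial>?Sx x)) \<partial>lborel)"
      by (rule nn_integral_sphere_polar[OF x N]) measurable
    also have "\<dots> = (\<integral>\<^sup>+r. indicator {0<..<pi} r * (ennreal (sin r ^ (DIM('a) - 2)) * (h r * ?I r x)) \<partial>lborel)"
    proof (rule nn_integral_cong)
      fix r :: real
      have "(\<integral>\<^sup>+w. h (angle x (cos r *\<^sub>R x + sin r *\<^sub>R w)) * q (x, cos r *\<^sub>R x + sin r *\<^sub>R w) \<partial>?Sx x) = h r * ?I r x"
        if r: "r \<in> {0<..<pi}"
      proof -
        have "(\<integral>\<^sup>+w. h (angle x (cos r *\<^sub>R x + sin r *\<^sub>R w)) * q (x, cos r *\<^sub>R x + sin r *\<^sub>R w) \<partial>?Sx x) =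
          (\<integral>\<^sup>+w. h r * q (x, cos r *\<^sub>R x + sin r *\<^sub>R w) \<partial>?Sx x)"
          using r by (intro nn_integral_cong) (simp add: angle_cos_sin[OF x])
        also have "\<dots> = h r * ?I r x"
          by (rule nn_integral_cmult) measurable
        finally show ?thesis .
      qed
      then show "indicator {0<..<pi} r * (ennreal (sin r ^ (DIM('a) - 2)) *
          (\<integral>\<^sup>+w. h (angle x (cos r *\<^sub>R x + sin r *\<^sub>R w)) * q (x, cos r *\<^sub>R x + sin r *\<^sub>R w) \<partial>?Sx x)) =
        indicator {0<..<pi} r * (ennreal (sin r ^ (DIM('a) - 2)) * (h r * ?I r x))"
        by (cases "r \<in> {0<..<pi}") simp_all
    qed
    finally show "(\<integral>\<^sup>+y. h (angle x y) * q (x, y) \<partial>?S) =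
      (\<integral>\<^sup>+r. indicator {0<..<pi} r * (ennreal (sin r ^ (DIM('a) - 2)) * (h r * ?I r x)) \<partial>lborel)" .
  qed
  also have "\<dots> = (\<integral>\<^sup>+r. \<integral>\<^sup>+x. indicator {0<..<pi} r * (ennreal (sin r ^ (DIM('a) - 2)) * (h r * ?I r x)) \<partial>?S \<partial>lborel)"
  proof (rule LS.Fubini')
    note [measurable] = I_meas
    have "(\<lambda>z. indicator {0<..<pi} (fst z) * (ennreal (sin (fst z) ^ (DIM('a) - 2)) * (h (fst z) * case_prod ?I z)))
        \<in> borel_measurable (lborel \<Otimes>\<^sub>M ?S)"
      by measurable
    then show "(\<lambda>(r, x). indicator {0<..<pi} r * (ennreal (sin r ^ (DIM('a) - 2)) * (h r * ?I r x)))
        \<in> borel_measurable (lborel \<Otimes>\<^sub>M ?S)"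
      by (simp add: case_prod_beta')
  qed
  also have "\<dots> = (\<integral>\<^sup>+r. indicator {0<..<pi} r * (ennreal (sin r ^ (DIM('a) - 2)) * (h r * pair_integral q r)) \<partial>lborel)"
    using I_meas' by (simp add: nn_integral_cmult pair_integral_def)
  finally show ?thesis .
qed

lemma pair_integral_Times_UNIV:
  fixes A :: "'a::euclidean_space set"
  assumes N: "DIM('a) = m + 2" and A: "A \<in> sets borel"
  shows "pair_integral (indicator (A \<times> UNIV)) r = ennreal (sphere_area m) * (\<integral>\<^sup>+x. indicator A x \<partial>unit_sphere_measure UNIV)"
proof -
  have "pair_integral (indicator (A \<times> UNIV)) r = (\<integral>\<^sup>+x. ennreal (sphere_area m) * indicator A x \<partial>unit_sphere_measure UNIV)"
    unfolding pair_integral_def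
  proof (rule nn_integral_cong)
    fix x :: 'a assume "x \<in> space (unit_sphere_measure UNIV)"
    then have "dim (tangent_space x) = m + 1" using N by (simp add: dim_tangent_space)
    note emeasure_space_unit_sphere_measure[OF subspace_tangent_space this]
    then have "(\<integral>\<^sup>+w. indicator A x \<partial>unit_sphere_measure (tangent_space x)) = indicator A x * ennreal (sphere_area m)"
      by simp
    moreover have "indicator (A \<times> UNIV) (x, v) = (indicator A x :: ennreal)" for v :: 'a
      by (simp add: indicator_def)
    ultimately show "(\<integral>\<^sup>+w. indicator (A \<times> UNIV) (x, cos r *\<^sub>R x + sin r *\<^sub>R w) \<partial>unit_sphere_measure (tangent_space x)) =
        ennreal (sphere_area m) * indicator A x"
      by (simp add: mult.commute)
  qed
  also have "\<dots> = ennreal (sphere_area m) * (\<integral>\<^sup>+x. indicator A x \<partial>unit_sphere_measure UNIV)"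
    by (intro nn_integral_cmult borel_measurable_unit_sphere_measure borel_measurable_indicator A)
  finally show ?thesis .
qed

text \<open>Finiteness makes the passage to real weights by \<open>enn2real\<close>
  lossless.\<close>

lemma pair_integral_indicator_finite:
  fixes Q :: "('a::euclidean_space \<times> 'a) set"
  assumes N: "DIM('a) = m + 2"
  shows "pair_integral (indicator Q) r < top"
proof -
  interpret S: finite_measure "unit_sphere_measure (UNIV :: 'a set)" by (rule finite_measure_sphere)
  have "pair_integral (indicator Q) r \<le> pair_integral (indicator (UNIV \<times> (UNIV :: 'a set))) r"
    unfolding pair_integral_def by (intro nn_integral_mono) (auto simp: indicator_def)
  also have "\<dots> = ennreal (sphere_area m) * emeasure (unit_sphere_measure (UNIV :: 'a set)) (space (unit_sphere_measure UNIV))"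
    by (subst pair_integral_Times_UNIV[OF N]) auto
  also have "\<dots> < top"
    using emeasure_space_unit_sphere_measure[of "UNIV :: 'a set" "m + 1"] N by (simp add: ennreal_mult_less_top)
  finally show ?thesis .
qed

text \<open>The push-forward of the measure on \<open>Q\<close> under the angle has a density, so signed kernels need
  no splitting into positive and negative parts.\<close>

lemma
  fixes Q :: "('a::euclidean_space \<times> 'a) set" and f :: "real \<Rightarrow> real"
  assumes N: "DIM('a) = m + 2" and Q: "Q \<in> sets (borel \<Otimes>\<^sub>M borel)" and f: "f \<in> borel_measurable borel"
  defines "P \<equiv> unit_sphere_measure UNIV \<Otimes>\<^sub>M unit_sphere_measure UNIV"
    and "W \<equiv> \<lambda>r. indicator {0<..<pi} r * (sin r ^ m * enn2real (pair_integral (indicator Q) r))"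
  shows integral_sphere_pairs: "(LINT z|P. indicator Q z * f (angle (fst z) (snd z))) = (LINT r|lborel. W r * f r)"
    and integrable_sphere_pairs: "integrable P (\<lambda>z. indicator Q z * f (angle (fst z) (snd z))) \<longleftrightarrow> integrable lborel (\<lambda>r. W r * f r)"
proof -
  let ?a = "\<lambda>z. angle (fst z) (snd z) :: real"
  let ?D = "density P (\<lambda>z. ennreal (indicator Q z))"
  note [measurable] = f Q
  have [measurable]: "(\<lambda>z. z) \<in> P \<rightarrow>\<^sub>M borel \<Otimes>\<^sub>M borel"
    using measurable_Pair[of fst P borel snd borel] unfolding P_def by simp
  have [measurable]: "?a \<in> borel_measurable P" unfolding P_def by measurable
  have ind_Q [measurable]: "(indicator Q :: _ \<Rightarrow> real) \<in> borel_measurable P"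
    using borel_measurable_indicator[OF Q] measurable_compose[of "\<lambda>z. z" P "borel \<Otimes>\<^sub>M borel"] by simp
  have [measurable]: "pair_integral (indicator Q) \<in> borel_measurable borel"
    by (rule borel_measurable_pair_integral) measurable
  have W_nn: "W r \<ge> 0" for r
  proof (cases "r \<in> {0<..<pi}")
    case True
    then show ?thesis by (auto simp: W_def intro!: mult_nonneg_nonneg zero_le_power sin_ge_zero)
  qed (simp add: W_def)
  have [measurable]: "W \<in> borel_measurable borel" unfolding W_def by measurable
  have W: "indicator {0<..<pi} r * (ennreal (sin r ^ m) * (h * pair_integral (indicator Q) r)) = ennreal (W r) * h" for r h
  proof (cases "r \<in> {0<..<pi}")
    case True
    then have "sin r ^ m \<ge> 0" by (intro zero_le_power sin_ge_zero) auto
    moreover have "pair_integral (indicator Q) r = ennreal (enn2real (pair_integral (indicator Q) r))"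
      using pair_integral_indicator_finite[OF N, of Q r] by simp
    ultimately have "ennreal (W r) = ennreal (sin r ^ m) * pair_integral (indicator Q) r"
      using True by (simp add: W_def ennreal_mult)
    then show ?thesis using True by (simp add: mult_ac)
  qed (simp add: W_def)
  \<comment> \<open>This is \<open>nn_integral_sphere_pairs\<close> with \<open>h\<close> the
    indicator of \<open>E\<close>.\<close>
  have eq: "distr ?D borel ?a = density lborel (\<lambda>r. ennreal (W r))"
  proof (rule measure_eqI)
    fix E assume "E \<in> sets (distr ?D borel ?a)"
    then have [measurable]: "E \<in> sets borel" by simp
    have "emeasure (distr ?D borel ?a) E = (\<integral>\<^sup>+r. indicator E r \<partial>distr ?D borel ?a)"
      by simp
    also have "\<dots> = (\<integral>\<^sup>+z. ennreal (indicator Q z) * indicator E (?a z) \<partial>P)"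
      by (subst nn_integral_distr, simp, simp, subst nn_integral_density) measurable
    also have "\<dots> = (\<integral>\<^sup>+z. indicator E (?a z) * indicator Q z \<partial>P)"
      by (simp add: mult.commute ennreal_indicator)
    also have "\<dots> = (\<integral>\<^sup>+r. indicator {0<..<pi} r * (ennreal (sin r ^ m) * (indicator E r * pair_integral (indicator Q) r)) \<partial>lborel)"
      unfolding P_def using N by (subst nn_integral_sphere_pairs) auto
    also have "\<dots> = emeasure (density lborel (\<lambda>r. ennreal (W r))) E"
      unfolding W by (simp add: emeasure_density)
    finally show "emeasure (distr ?D borel ?a) E = emeasure (density lborel (\<lambda>r. ennreal (W r))) E" .
  qed simp
  have "(LINT z|P. indicator Q z * f (?a z)) = integral\<^sup>L (distr ?D borel ?a) f"
    by (subst integral_distr, simp, simp, subst integral_density) auto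
  also have "\<dots> = (LINT r|lborel. W r * f r)"
    unfolding eq using W_nn by (subst integral_density) auto
  finally show "(LINT z|P. indicator Q z * f (?a z)) = (LINT r|lborel. W r * f r)" .
  have "integrable P (\<lambda>z. indicator Q z * f (?a z)) \<longleftrightarrow> integrable (distr ?D borel ?a) f"
    by (subst integrable_distr_eq, simp, simp, subst integrable_density) auto
  also have "\<dots> \<longleftrightarrow> integrable lborel (\<lambda>r. W r * f r)"
    unfolding eq using W_nn by (subst integrable_density) auto
  finally show "integrable P (\<lambda>z. indicator Q z * f (?a z)) \<longleftrightarrow> integrable lborel (\<lambda>r. W r * f r)" .
qed

text \<open>In polar coordinates about \<open>a\<close>, a point with \<open>0 < r < pi\<close> has
  angle \<open>r \<noteq> 0\<close> from \<open>a\<close>.\<close>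

lemma AE_sphere_neq:
  fixes a :: "'a::euclidean_space"
  assumes N: "DIM('a) \<ge> 2"
  shows "AE x in unit_sphere_measure UNIV. x \<noteq> a"
proof (cases "a \<in> sphere 0 1")
  case True
  have "(\<integral>\<^sup>+x. indicator {a} x \<partial>unit_sphere_measure UNIV) = (\<integral>\<^sup>+r. indicator {0<..<pi} r * (ennreal (sin r ^ (DIM('a) - 2)) *
      (\<integral>\<^sup>+w. indicator {a} (cos r *\<^sub>R a + sin r *\<^sub>R w) \<partial>unit_sphere_measure (tangent_space a))) \<partial>lborel)"
    by (rule nn_integral_sphere_polar[OF True N]) auto
  also have "\<dots> = (\<integral>\<^sup>+r. 0 \<partial>(lborel :: real measure))"
  proof (rule nn_integral_cong)
    fix r :: real
    have "(\<integral>\<^sup>+w. indicator {a} (cos r *\<^sub>R a + sin r *\<^sub>R w) \<partial>unit_sphere_measure (tangent_space a)) =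
        (\<integral>\<^sup>+w. 0 \<partial>unit_sphere_measure (tangent_space a))" if r: "r \<in> {0<..<pi}"
    proof (rule nn_integral_cong)
      fix w assume w: "w \<in> space (unit_sphere_measure (tangent_space a))"
      have "angle a a = 0"
        using True by (simp add: angle_eq_arccos dot_square_norm)
      then have "cos r *\<^sub>R a + sin r *\<^sub>R w \<noteq> a"
        using angle_cos_sin[OF True, of w r] w r by auto
      then show "indicator {a} (cos r *\<^sub>R a + sin r *\<^sub>R w) = (0 :: ennreal)" by simp
    qed
    then show "indicator {0<..<pi} r * (ennreal (sin r ^ (DIM('a) - 2)) *
      (\<integral>\<^sup>+w. indicator {a} (cos r *\<^sub>R a + sin r *\<^sub>R w) \<partial>unit_sphere_measure (tangent_space a))) = 0"
      by (cases "r \<in> {0<..<pi}") simp_all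
  qed
  finally have "(\<integral>\<^sup>+x. indicator {a} x \<partial>unit_sphere_measure UNIV) = 0" by simp
  then have "AE x in unit_sphere_measure UNIV. indicator {a} x = (0 :: ennreal)"
    by (subst (asm) nn_integral_0_iff_AE) auto
  then show ?thesis by eventually_elim (auto simp: indicator_def)
next
  case False
  then show ?thesis by (intro AE_I2) auto
qed

subsection \<open>The autocorrelation function\<close>

lemma sphere_exp_unit:
  assumes "norm w = 1" "r > 0"
  shows "sphere_exp x (r *\<^sub>R w) = cos r *\<^sub>R x + sin r *\<^sub>R w"
  using assms by (simp add: sphere_exp_def sgn_scaleR) (simp add: sgn_div_norm)

text \<open>The radius 0 lies outside the range of \<open>autocorrelation_eq_pair_integral\<close>.
  Here \<open>sphere_exp x 0 = x\<close>, so the inner integrand is constant in \<open>w\<close> and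
  the area of the tangent sphere cancels the normalising factor.\<close>

lemma autocorrelation_0:
  fixes A \<Omega> :: "'a::euclidean_space set"
  assumes N: "DIM('a) = m + 2" and A: "A \<in> sets borel"
    and ae: "AE x in unit_sphere_measure UNIV. x \<in> \<Omega> \<longleftrightarrow> x \<in> A"
  shows "autocorrelation \<Omega> 0 = (LINT x|unit_sphere_measure UNIV. indicator A x)"
proof -
  have inner: "1 / sphere_area m * (LINT w|tangent_sphere_measure x. indicator \<Omega> x * indicator \<Omega> (sphere_exp x (0 *\<^sub>R w))) = indicator \<Omega> x"
    if x: "x \<in> sphere 0 1" for x :: 'a
  proof -
    have "dim (tangent_space x) = m + 1" using N x by (simp add: dim_tangent_space)
    note emeasure_space_unit_sphere_measure[OF subspace_tangent_space this]
    then have "measure (unit_sphere_measure (tangent_space x)) (space (unit_sphere_measure (tangent_space x))) = sphere_area m"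
      using sphere_area_pos[of m] by (simp add: measure_def)
    then have "measure (tangent_sphere_measure x) (space (tangent_sphere_measure x)) = sphere_area m"
      by (simp add: tangent_sphere_measure_def del: space_unit_sphere_measure)
    then show ?thesis
      using sphere_area_pos[of m] by (cases "x \<in> \<Omega>") (simp_all add: sphere_exp_def)
  qed
  have "autocorrelation \<Omega> 0 = (LINT x|sphere_volume. indicator \<Omega> x)"
    unfolding autocorrelation_def
  proof (rule Bochner_Integration.integral_cong[OF refl])
    fix x :: 'a assume "x \<in> space sphere_volume"
    then have "x \<in> sphere 0 1" by (simp add: sphere_volume_def)
    from inner[OF this] show "1 / sphere_area (DIM('a) - 2) *
        (LINT w|tangent_sphere_measure x. indicator \<Omega> x * indicator \<Omega> (sphere_exp x (0 *\<^sub>R w))) = indicator \<Omega> x"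
      by (simp add: N)
  qed
  also have "\<dots> = (LINT x|unit_sphere_measure UNIV. indicator A x)"
    unfolding sphere_volume_def
  proof (rule integral_completion_AE)
    show "(indicator A :: 'a \<Rightarrow> real) \<in> borel_measurable (unit_sphere_measure UNIV)"
      by (intro borel_measurable_unit_sphere_measure borel_measurable_indicator A)
    show "AE x in unit_sphere_measure UNIV. indicator \<Omega> x = (indicator A x :: real)"
      using ae by eventually_elim (simp add: indicator_def)
  qed
  finally show ?thesis .
qed

lemma autocorrelation_eq_pair_integral:
  fixes A \<Omega> Z :: "'a::euclidean_space set"
  assumes N: "DIM('a) = m + 2" and A [measurable]: "A \<in> sets borel" and Z [measurable]: "Z \<in> sets borel"
    and null: "(\<integral>\<^sup>+x. indicator Z x \<partial>unit_sphere_measure UNIV) = 0"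
    and \<Omega>: "\<And>x. x \<in> sphere 0 1 \<Longrightarrow> x \<notin> Z \<Longrightarrow> x \<in> \<Omega> \<longleftrightarrow> x \<in> A"
    and r: "0 < r" "r < pi"
  shows "sphere_area m * autocorrelation \<Omega> r = enn2real (pair_integral (indicator (A \<times> A)) r)"
proof -
  let ?S = "unit_sphere_measure UNIV :: 'a measure"
  let ?Sx = "\<lambda>x. unit_sphere_measure (tangent_space x) :: 'a measure"
  define e where "e x w = cos r *\<^sub>R x + sin r *\<^sub>R w" for x w :: 'a
  define I where "I x = (\<integral>\<^sup>+w. indicator (A \<times> A) (x, e x w) \<partial>?Sx x)" for x
  have N2: "DIM('a) \<ge> 2" using N by simp
  have [measurable]: "e x \<in> borel_measurable borel" for x unfolding e_def by measurable
  have e_sphere: "e x w \<in> sphere 0 1" if "x \<in> sphere 0 1" "w \<in> sphere 0 1 \<inter> tangent_space x" for x w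
    using norm_cos_sin[of x w r] that by (simp add: e_def tangent_space_def orthogonal_def)
  have [measurable]: "I \<in> borel_measurable ?S"
    unfolding I_def e_def by (rule borel_measurable_tangent_sphere_average') measurable
  have I_fin: "I x < top" if x: "x \<in> sphere 0 1" for x
  proof -
    have "I x \<le> (\<integral>\<^sup>+w. 1 \<partial>?Sx x)"
      unfolding I_def by (intro nn_integral_mono) (simp add: indicator_def)
    also have "\<dots> < top"
      using emeasure_space_unit_sphere_measure[OF subspace_tangent_space[of x], of m] dim_tangent_space[OF x] N by simp
    finally show ?thesis .
  qed
  have "AE x in ?S. indicator Z x = (0 :: ennreal)"
    using null by (subst (asm) nn_integral_0_iff_AE) (auto intro!: borel_measurable_unit_sphere_measure)
  then have AE_Z: "AE x in ?S. x \<notin> Z"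
    by eventually_elim (auto simp: indicator_def)
  \<comment> \<open>Controls the second exceptional set: for almost every \<open>x\<close>, the
    geodesic of length \<open>r\<close> from \<open>x\<close> ends in \<open>Z\<close> only for a
    null set of directions \<open>w\<close>.\<close>
  have "(\<integral>\<^sup>+x. \<integral>\<^sup>+w. indicator Z (e x w) \<partial>?Sx x \<partial>?S) = 0"
    unfolding e_def using N2 null by (intro nn_integral_geodesic_average_null) measurable
  moreover have "(\<lambda>x. \<integral>\<^sup>+w. indicator Z (e x w) \<partial>?Sx x) \<in> borel_measurable ?S"
    using borel_measurable_tangent_sphere_average'[where q="\<lambda>z. indicator Z (snd z)" and r=r] by (simp add: e_def)
  ultimately have AE_eZ: "AE x in ?S. (\<integral>\<^sup>+w. indicator Z (e x w) \<partial>?Sx x) = 0"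
    by (simp add: nn_integral_0_iff_AE)
  have inner: "AE x in ?S. 1 / sphere_area (DIM('a) - 2) *
      (LINT w|tangent_sphere_measure x. indicator \<Omega> x * indicator \<Omega> (sphere_exp x (r *\<^sub>R w))) = 1 / sphere_area m * enn2real (I x)"
    using AE_Z AE_eZ AE_space
  proof eventually_elim
    case (elim x)
    then have x: "x \<in> sphere 0 1" by simp
    have g_meas: "(\<lambda>w. indicator (A \<times> A) (x, e x w) :: real) \<in> borel_measurable (?Sx x)"
      by (rule borel_measurable_unit_sphere_measure) measurable
    have "AE w in ?Sx x. indicator Z (e x w) = (0 :: ennreal)"
      using elim(2) by (subst (asm) nn_integral_0_iff_AE) (auto intro!: borel_measurable_unit_sphere_measure)
    then have ae: "AE w in ?Sx x. indicator \<Omega> x * indicator \<Omega> (sphere_exp x (r *\<^sub>R w)) = (indicator (A \<times> A) (x, e x w) :: real)"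
      using AE_space
    proof eventually_elim
      case (elim w)
      then have w: "w \<in> sphere 0 1 \<inter> tangent_space x" by simp
      have "e x w \<notin> Z" using elim(1) by (auto simp: indicator_def)
      then have "e x w \<in> \<Omega> \<longleftrightarrow> e x w \<in> A" using \<Omega> e_sphere[OF x w] by blast
      moreover have "x \<in> \<Omega> \<longleftrightarrow> x \<in> A" using \<Omega> x \<open>x \<notin> Z\<close> by blast
      moreover have "sphere_exp x (r *\<^sub>R w) = e x w"
        using w r by (simp add: sphere_exp_unit e_def)
      ultimately show ?case by (simp add: indicator_def)
    qed
    have "(LINT w|tangent_sphere_measure x. indicator \<Omega> x * indicator \<Omega> (sphere_exp x (r *\<^sub>R w))) =
        (LINT w|?Sx x. indicat_real (A \<times> A) (x, e x w))"
      unfolding tangent_sphere_measure_def by (rule integral_completion_AE[OF g_meas ae])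
    also have "\<dots> = enn2real (I x)"
      unfolding I_def by (subst integral_eq_nn_integral[OF g_meas]) (simp_all add: ennreal_indicator)
    finally show ?case by (simp add: N)
  qed
  have "autocorrelation \<Omega> r = (LINT x|?S. 1 / sphere_area m * enn2real (I x))"
    unfolding autocorrelation_def sphere_volume_def by (rule integral_completion_AE[OF _ inner]) measurable
  also have "\<dots> = 1 / sphere_area m * (LINT x|?S. enn2real (I x))" by simp
  also have "(LINT x|?S. enn2real (I x)) = enn2real (\<integral>\<^sup>+x. ennreal (enn2real (I x)) \<partial>?S)"
    by (rule integral_eq_nn_integral) auto
  also have "(\<integral>\<^sup>+x. ennreal (enn2real (I x)) \<partial>?S) = (\<integral>\<^sup>+x. I x \<partial>?S)"
    using I_fin by (intro nn_integral_cong) simp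
  also have "\<dots> = pair_integral (indicator (A \<times> A)) r"
    by (simp add: pair_integral_def I_def e_def)
  finally show ?thesis using sphere_area_pos[of m] by simp
qed

text \<open>The exceptional set is returned as a Borel set rather than inside an almost-everywhere
  statement, because it is later tested at the end points of geodesics.\<close>

lemma sets_sphere_volumeE:
  fixes \<Omega> :: "'a::euclidean_space set"
  assumes "\<Omega> \<in> sets sphere_volume"
  obtains A Z where "A \<in> sets borel" "Z \<in> sets borel"
    "(\<integral>\<^sup>+x. indicator Z x \<partial>unit_sphere_measure UNIV) = 0"
    "\<And>x. x \<in> sphere 0 1 \<Longrightarrow> x \<notin> Z \<Longrightarrow> x \<in> \<Omega> \<longleftrightarrow> x \<in> A"
proof -
  let ?S = "unit_sphere_measure UNIV :: 'a measure"
  from assms obtain A M Z where *: "\<Omega> = A \<union> M" "M \<subseteq> Z" "Z \<in> null_sets ?S" "A \<in> sets ?S"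
    unfolding sphere_volume_def by (rule sets_completionE)
  have sub: "sets ?S \<subseteq> sets borel"
    unfolding sets_unit_sphere_measure by (auto simp: sets_restrict_space)
  have Z: "Z \<in> sets ?S" "emeasure ?S Z = 0" using *(3) by auto
  then have "(\<integral>\<^sup>+x. indicator Z x \<partial>?S) = 0" by simp
  then show thesis using that[of A Z] * Z sub by auto
qed

text \<open>Off the diagonal and the antipodal pairs, \<open>radial_profile_eq\<close> expresses the
  kernel through the angle.\<close>

lemma AE_sphere_pair_neq:
  assumes N: "DIM('a::euclidean_space) \<ge> 2"
  shows "AE z in unit_sphere_measure UNIV \<Otimes>\<^sub>M unit_sphere_measure (UNIV :: 'a set). fst z \<noteq> snd z \<and> fst z \<noteq> - snd z"
proof -
  let ?S = "unit_sphere_measure UNIV :: 'a measure"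
  interpret S: finite_measure ?S by (rule finite_measure_sphere)
  interpret SS: pair_sigma_finite ?S ?S ..
  show ?thesis
  proof (rule SS.AE_pair_measure)
    show "{z \<in> space (?S \<Otimes>\<^sub>M ?S). fst z \<noteq> snd z \<and> fst z \<noteq> - snd z} \<in> sets (?S \<Otimes>\<^sub>M ?S)"
      by measurable
    have "AE y in ?S. x \<noteq> y \<and> x \<noteq> - y" for x
      using AE_sphere_neq[OF N, of x] AE_sphere_neq[OF N, of "- x"] by eventually_elim auto
    then show "AE x in ?S. AE y in ?S. fst (x, y) \<noteq> snd (x, y) \<and> fst (x, y) \<noteq> - snd (x, y)"
      by simp
  qed
qed

theorem lemma5p5:
  fixes n :: nat and \<Omega> :: "'a::euclidean_space set" and \<epsilon> :: real
    and K :: "'a \<Rightarrow> 'a \<Rightarrow> real" and k :: "real \<Rightarrow> real"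
  assumes "n \<ge> 2" and "DIM('a) = n + 1"
    and "\<Omega> \<in> sets sphere_volume"
    and "\<epsilon> > 0"
    and "helmholtz_kernel \<epsilon> K"
    and "radial_profile K k"
  shows "(LINT z|sphere_volume2.
            K (fst z) (snd z) * \<bar>indicator \<Omega> (fst z) - indicator \<Omega> (snd z)\<bar>) =
         2 * sphere_area (n - 1) *
           (LBINT r=0..pi. k r * sin r ^ (n - 1) * (autocorrelation \<Omega> 0 - autocorrelation \<Omega> r))"
proof -
  let ?S = "unit_sphere_measure UNIV :: 'a measure"
  let ?P = "?S \<Otimes>\<^sub>M ?S"
  let ?a = "\<lambda>z :: 'a \<times> 'a. angle (fst z) (snd z)"
  define m where "m = n - 1"
  have m: "DIM('a) = m + 2" "n = Suc m" using assms(1,2) by (auto simp: m_def)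
  have N: "DIM('a) \<ge> 2" using m by simp
  let ?s = "sphere_area m"
  interpret S: finite_measure ?S by (rule finite_measure_sphere)
  interpret SS: pair_sigma_finite ?S ?S ..

  \<comment> \<open>A Borel representative of the set\<close>
  obtain A Z where A [measurable]: "A \<in> sets borel" and Z [measurable]: "Z \<in> sets borel"
    and null: "(\<integral>\<^sup>+x. indicator Z x \<partial>?S) = 0"
    and \<Omega>: "\<And>x. x \<in> sphere 0 1 \<Longrightarrow> x \<notin> Z \<Longrightarrow> x \<in> \<Omega> \<longleftrightarrow> x \<in> A"
    by (rule sets_sphere_volumeE[OF assms(3)]) blast
  have "AE x in ?S. indicator Z x = (0 :: ennreal)"
    using null by (subst (asm) nn_integral_0_iff_AE) (auto intro!: borel_measurable_unit_sphere_measure)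
  then have AE_Z: "AE x in ?S. x \<in> \<Omega> \<longleftrightarrow> x \<in> A"
    using AE_space by eventually_elim (use \<Omega> in \<open>auto simp: indicator_def\<close>)
  have AE_notin_Z: "AE x in ?S. x \<notin> Z"
    using \<open>AE x in ?S. indicator Z x = (0 :: ennreal)\<close> by eventually_elim (auto simp: indicator_def)
  define c where "c = (LINT x|?S. indicat_real A x)"
  have c0: "autocorrelation \<Omega> 0 = c"
    unfolding c_def by (rule autocorrelation_0[OF m(1) A AE_Z])
  have c_nn: "c \<ge> 0" unfolding c_def by (rule Bochner_Integration.integral_nonneg) simp
  have "(\<integral>\<^sup>+x. indicator A x \<partial>?S) = (\<integral>\<^sup>+x. ennreal (indicator A x) \<partial>?S)"
    by (simp add: ennreal_indicator)
  also have "\<dots> = ennreal c"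
    unfolding c_def
  proof (rule nn_integral_eq_integral)
    show "integrable ?S (indicat_real A)"
      by (rule S.integrable_const_bound[where B=1])
         (auto intro!: borel_measurable_unit_sphere_measure simp: indicator_def)
  qed simp
  finally have A_int: "(\<integral>\<^sup>+x. indicator A x \<partial>?S) = ennreal c" .

  \<comment> \<open>The kernel as a Borel function of the angle\<close>
  obtain y0 :: 'a where y0: "y0 \<in> sphere 0 1"
    using nonempty_Basis norm_Basis by (metis all_not_in_conv mem_sphere_0)
  have K0: "integrable sphere_volume (\<lambda>x. K x y0)" and "smooth_on_sphere (sphere 0 1 - {y0}) (\<lambda>x. K x y0)"
    using assms(5) y0 unfolding helmholtz_kernel_def by blast+
  then have k_cont: "continuous_on {0<..<pi} k"
    by (intro continuous_on_radial_profile[OF N assms(6) y0] smooth_on_sphere_imp_continuous_on)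
  \<comment> \<open>Extension by 0, since \<open>k\<close> is arbitrary outside
    \<open>(0, pi)\<close>; continuity on the open interval then makes \<open>kk\<close> Borel on
    the whole line.\<close>
  define kk where "kk r = indicator {0<..<pi} r *\<^sub>R k r" for r
  have kk_meas [measurable]: "kk \<in> borel_measurable borel"
    unfolding kk_def by (rule borel_measurable_continuous_on_indicator[OF _ k_cont]) simp
  have K_eq: "K x y = kk (angle x y)" if "x \<in> sphere 0 1" "y \<in> sphere 0 1" "x \<noteq> y" "x \<noteq> - y" for x y
    using radial_profile_eq[OF assms(6) that] that by (simp add: kk_def angle_eq_arccos)

  \<comment> \<open>Integrability of the weighted radial kernel\<close>
  define \<omega> where "\<omega> r = indicator {0<..<pi} r * sin r ^ m" for r :: real
  have \<omega>_nn: "\<omega> r \<ge> 0" for r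
    by (cases "r \<in> {0<..<pi}") (auto simp: \<omega>_def intro!: zero_le_power sin_ge_zero)
  have "\<omega> \<in> borel_measurable borel" unfolding \<omega>_def by measurable
  then have \<omega>kk_meas: "(\<lambda>r. \<omega> r * kk r) \<in> borel_measurable lborel"
    using kk_meas by (intro borel_measurable_times) simp_all
  \<comment> \<open>In polar coordinates about \<open>y0\<close>, the integral of
    \<open>|K(\<cdot>, y0)|\<close> over the sphere is \<open>?s\<close> times the integral of
    \<open>|\<omega> kk|\<close>.\<close>
  have int_\<omega>: "integrable lborel (\<lambda>r. \<omega> r * kk r)"
  proof (rule integrableI_bounded)
    have ae: "AE x in ?S. K x y0 = kk (angle y0 x)"
      using AE_sphere_neq[OF N, of y0] AE_sphere_neq[OF N, of "- y0"] AE_space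
      by eventually_elim (use y0 in \<open>simp add: K_eq angle_commute[of y0]\<close>)
    have "integrable ?S (\<lambda>x. kk (angle y0 x))"
      by (rule integrable_completion_AE[OF _ ae, THEN iffD1, OF _ K0[unfolded sphere_volume_def]]) measurable
    then have "(\<integral>\<^sup>+x. ennreal (norm (kk (angle y0 x))) \<partial>?S) < \<infinity>"
      by (simp add: integrable_iff_bounded)
    also have "(\<integral>\<^sup>+x. ennreal (norm (kk (angle y0 x))) \<partial>?S) =
      (\<integral>\<^sup>+r. indicator {0<..<pi} r * (ennreal (sin r ^ m) *
        (\<integral>\<^sup>+w. ennreal (norm (kk (angle y0 (cos r *\<^sub>R y0 + sin r *\<^sub>R w)))) \<partial>unit_sphere_measure (tangent_space y0))) \<partial>lborel)"
      using nn_integral_sphere_polar[OF y0 N, of "\<lambda>x. ennreal (norm (kk (angle y0 x)))"] by (simp add: m)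
    also have "\<dots> = (\<integral>\<^sup>+r. ennreal (norm (\<omega> r * kk r)) * ennreal ?s \<partial>lborel)"
    proof (rule nn_integral_cong)
      fix r :: real
      show "indicator {0<..<pi} r * (ennreal (sin r ^ m) *
        (\<integral>\<^sup>+w. ennreal (norm (kk (angle y0 (cos r *\<^sub>R y0 + sin r *\<^sub>R w)))) \<partial>unit_sphere_measure (tangent_space y0))) =
        ennreal (norm (\<omega> r * kk r)) * ennreal ?s"
      proof (cases "r \<in> {0<..<pi}")
        case True
        have "(\<integral>\<^sup>+w. ennreal (norm (kk (angle y0 (cos r *\<^sub>R y0 + sin r *\<^sub>R w)))) \<partial>unit_sphere_measure (tangent_space y0)) =
          (\<integral>\<^sup>+w. ennreal (norm (kk r)) \<partial>unit_sphere_measure (tangent_space y0))"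
          using True by (intro nn_integral_cong) (simp add: angle_cos_sin[OF y0])
        also have "\<dots> = ennreal (norm (kk r)) * ennreal ?s"
          using emeasure_space_unit_sphere_measure[OF subspace_tangent_space[of y0], of m] dim_tangent_space[OF y0] m by simp
        finally show ?thesis
          using True \<omega>_nn[of r] by (simp add: \<omega>_def abs_mult ennreal_mult mult.assoc)
      qed (simp add: \<omega>_def)
    qed
    also have "\<dots> = (\<integral>\<^sup>+r. ennreal (norm (\<omega> r * kk r)) \<partial>lborel) * ennreal ?s"
      by (rule nn_integral_multc) (rule measurable_compose[OF \<omega>kk_meas, where g="\<lambda>t. ennreal (norm t)"], measurable)
    finally show "(\<integral>\<^sup>+r. ennreal (norm (\<omega> r * kk r)) \<partial>lborel) < \<infinity>"
      using sphere_area_pos[of m] by (auto simp: ennreal_mult_less_top)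
  qed (rule \<omega>kk_meas)

  \<comment> \<open>Integrability over sets of pairs\<close>
  let ?F = "\<lambda>Q z. indicator Q z * kk (?a z)"
  have idP [measurable]: "(\<lambda>z. z) \<in> ?P \<rightarrow>\<^sub>M borel \<Otimes>\<^sub>M borel"
    using measurable_Pair[of fst ?P borel snd borel] by simp
  have F_meas: "?F Q \<in> borel_measurable ?P" if "Q \<in> sets (borel \<Otimes>\<^sub>M borel)" for Q
  proof -
    have "(indicator Q :: _ \<Rightarrow> real) \<in> borel_measurable ?P"
      using measurable_compose[OF idP borel_measurable_indicator[OF that]] by simp
    then show ?thesis by measurable
  qed
  let ?W = "\<lambda>Q r. indicator {0<..<pi} r * (sin r ^ m * enn2real (pair_integral (indicator Q) r))"
  have W_Times: "?W (B \<times> UNIV) r = \<omega> r * (?s * b)"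
    if "B \<in> sets borel" "(\<integral>\<^sup>+x. indicator B x \<partial>?S) = ennreal b" "b \<ge> 0" for B :: "'a set" and b r
    using that sphere_area_pos[of m]
    by (simp add: pair_integral_Times_UNIV[OF m(1) that(1)] \<omega>_def enn2real_mult)
  \<comment> \<open>For all pairs, the weight \<open>?W\<close> is a constant multiple of
    \<open>\<omega>\<close>. The resulting integrable function dominates \<open>?F Q\<close> for
    every measurable \<open>Q\<close>.\<close>
  have int_UNIV: "integrable ?P (?F (UNIV \<times> UNIV))"
  proof (subst integrable_sphere_pairs[OF m(1)])
    have "(\<integral>\<^sup>+x. indicator (UNIV :: 'a set) x \<partial>?S) = ennreal (measure ?S (space ?S))"
      by (simp add: S.emeasure_eq_measure)
    then have W: "?W (UNIV \<times> (UNIV :: 'a set)) r = \<omega> r * (?s * measure ?S (space ?S))" for r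
      by (intro W_Times) auto
    have "integrable lborel (\<lambda>r. (?s * measure ?S (space ?S)) * (\<omega> r * kk r))"
      using int_\<omega> by (rule integrable_mult_right)
    then show "integrable lborel (\<lambda>r. ?W (UNIV \<times> (UNIV :: 'a set)) r * kk r)"
      unfolding W by (simp only: mult_ac)
    show "UNIV \<times> UNIV \<in> sets (borel \<Otimes>\<^sub>M (borel :: 'a measure))"
      by (rule pair_measureI) auto
  qed (rule kk_meas)
  have int_F: "integrable ?P (?F Q)" if "Q \<in> sets (borel \<Otimes>\<^sub>M borel)" for Q
    by (rule Bochner_Integration.integrable_bound[OF int_UNIV F_meas[OF that]]) (simp add: indicator_def)
  have Q_sets: "A \<times> UNIV \<in> sets (borel \<Otimes>\<^sub>M (borel :: 'a measure))" "UNIV \<times> A \<in> sets ((borel :: 'a measure) \<Otimes>\<^sub>M borel)"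
    "A \<times> A \<in> sets (borel \<Otimes>\<^sub>M borel)" by auto

  \<comment> \<open>Evaluation of the double integral\<close>
  have lhs: "(LINT z|sphere_volume2. K (fst z) (snd z) * \<bar>indicator \<Omega> (fst z) - indicator \<Omega> (snd z)\<bar>) =
      (LINT z|?P. ?F (A \<times> UNIV) z + ?F (UNIV \<times> A) z - 2 * ?F (A \<times> A) z)"
    unfolding sphere_volume2_def
  proof (rule integral_completion_AE)
    show "(\<lambda>z. ?F (A \<times> UNIV) z + ?F (UNIV \<times> A) z - 2 * ?F (A \<times> A) z) \<in> borel_measurable ?P"
      using F_meas Q_sets by (intro borel_measurable_diff borel_measurable_add borel_measurable_times borel_measurable_const) auto
    have "AE z in ?P. fst z \<notin> Z \<and> snd z \<notin> Z"
    proof (rule SS.AE_pair_measure)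
      show "{z \<in> space ?P. fst z \<notin> Z \<and> snd z \<notin> Z} \<in> sets ?P"
        by measurable
      show "AE x in ?S. AE y in ?S. fst (x, y) \<notin> Z \<and> snd (x, y) \<notin> Z"
        using AE_notin_Z by eventually_elim (use AE_notin_Z in simp)
    qed
    then show "AE z in ?P. K (fst z) (snd z) * \<bar>indicator \<Omega> (fst z) - indicator \<Omega> (snd z)\<bar> =
        ?F (A \<times> UNIV) z + ?F (UNIV \<times> A) z - 2 * ?F (A \<times> A) z"
      using AE_sphere_pair_neq[OF N] AE_space
    proof eventually_elim
      case (elim z)
      obtain x y where z: "z = (x, y)" by (cases z)
      have xy: "x \<in> sphere 0 1" "y \<in> sphere 0 1" using elim(3) by (simp_all add: z space_pair_measure)
      have "x \<in> \<Omega> \<longleftrightarrow> x \<in> A" "y \<in> \<Omega> \<longleftrightarrow> y \<in> A" using \<Omega> xy elim(1) by (auto simp: z)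
      then show ?case
        using K_eq[OF xy] elim(2) by (simp add: z indicator_def)
    qed
  qed
  also have "\<dots> = (LINT z|?P. ?F (A \<times> UNIV) z) + (LINT z|?P. ?F (UNIV \<times> A) z) - 2 * (LINT z|?P. ?F (A \<times> A) z)"
    using int_F[OF Q_sets(1)] int_F[OF Q_sets(2)] int_F[OF Q_sets(3)] by simp
  also have "(LINT z|?P. ?F (UNIV \<times> A) z) = (LINT z|?P. ?F (A \<times> UNIV) z)"
  proof -
    have "(\<lambda>(x, y). ?F (A \<times> UNIV) (y, x)) = ?F (UNIV \<times> A)"
      by (auto simp: fun_eq_iff indicator_def angle_commute)
    then show ?thesis
      using SS.integral_product_swap[OF F_meas[OF Q_sets(1)]] by simp
  qed
  also have "(LINT z|?P. ?F (A \<times> UNIV) z) = (LINT r|lborel. (?s * c) * (\<omega> r * kk r))"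
    by (subst integral_sphere_pairs[OF m(1) Q_sets(1)], simp, unfold W_Times[OF A A_int c_nn]) (simp only: mult_ac)
  also have "(LINT z|?P. ?F (A \<times> A) z) = (LINT r|lborel. ?W (A \<times> A) r * kk r)"
    by (rule integral_sphere_pairs[OF m(1) Q_sets(3)]) simp
  finally have lhs_eq: "(LINT z|sphere_volume2. K (fst z) (snd z) * \<bar>indicator \<Omega> (fst z) - indicator \<Omega> (snd z)\<bar>) =
      2 * ((LINT r|lborel. (?s * c) * (\<omega> r * kk r)) - (LINT r|lborel. ?W (A \<times> A) r * kk r))"
    by simp

  \<comment> \<open>Comparison with the one-dimensional integral\<close>
  have int_W: "integrable lborel (\<lambda>r. ?W (A \<times> A) r * kk r)"
    using int_F[OF Q_sets(3)] by (subst (asm) integrable_sphere_pairs[OF m(1) Q_sets(3)]) simp_all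
  \<comment> \<open>Dropping the end points leaves only radii at which the autocorrelation is a pair
    integral.\<close>
  have "(LBINT r=0..pi. k r * sin r ^ m * (c - autocorrelation \<Omega> r)) =
      (LINT r|lborel. indicator {0<..<pi} r *\<^sub>R (k r * sin r ^ m * (c - autocorrelation \<Omega> r)))"
    by (subst interval_integral_Ioo) (auto simp: set_lebesgue_integral_def)
  then have "?s * (LBINT r=0..pi. k r * sin r ^ m * (c - autocorrelation \<Omega> r)) =
      (LINT r|lborel. ?s * (indicator {0<..<pi} r *\<^sub>R (k r * sin r ^ m * (c - autocorrelation \<Omega> r))))"
    by simp
  also have "\<dots> = (LINT r|lborel. (?s * c) * (\<omega> r * kk r) - ?W (A \<times> A) r * kk r)"
  proof (rule Bochner_Integration.integral_cong[OF refl])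
    fix r :: real
    show "?s * (indicator {0<..<pi} r *\<^sub>R (k r * sin r ^ m * (c - autocorrelation \<Omega> r))) =
        (?s * c) * (\<omega> r * kk r) - ?W (A \<times> A) r * kk r"
    proof (cases "r \<in> {0<..<pi}")
      case True
      then have "enn2real (pair_integral (indicator (A \<times> A)) r) = ?s * autocorrelation \<Omega> r"
        by (intro autocorrelation_eq_pair_integral[symmetric, OF m(1) A Z null \<Omega>]) auto
      then show ?thesis using True by (simp add: \<omega>_def kk_def algebra_simps)
    qed (simp add: \<omega>_def)
  qed
  also have "\<dots> = (LINT r|lborel. (?s * c) * (\<omega> r * kk r)) - (LINT r|lborel. ?W (A \<times> A) r * kk r)"
    by (intro Bochner_Integration.integral_diff integrable_mult_right int_\<omega> int_W)
  finally show ?thesis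
    unfolding lhs_eq c0 m_def[symmetric] by simp
qed

end
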